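(* Let $G$ be a Cohen--Macaulay very well-covered graph with $2n$ vertices $x_1,\dots,x_n,y_1,\dots,y_n$ in standard labelling, and let $J=I(G)^\vee$ be its cover ideal. Then the complex $$\mathbb F:\ \cdots\to F_i\xrightarrow{d_i}F_{i-1}\to\cdots\to F_1\xrightarrow{d_1}F_0\xrightarrow{d_0}J\to 0$$ defined as follows is the minimal (multigraded) free resolution of $J$: the free $S$-module $F_i$ has as basis the symbols $\mathbf f(C;\sigma)$ of multidegree $\mathbf z_C\mathbf x_\sigma$, where $C\in\mathcal C(G)$ and $\sigma\subseteq\mathcal C(G;C)$ with $|\sigma|=i$; the differentials are given by $d_0(\mathbf f(C;\emptyset))=\mathbf z_C$ and, for $i>0$, $$d_i(\mathbf f(C;\sigma))=\sum_{x_s\in\sigma}(-1)^{\alpha(\sigma;x_s)}\big[\,y_s\,\mathbf f((C\setminus y_s)\cup x_s;\sigma\setminus x_s)-x_s\,\mathbf f(C;\sigma\setminus x_s)\big],$$ where $\alpha(\sigma;x_s)=|\{x_j\in\sigma: j>s\}|$.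
   Context: Graphs are finite, simple and undirected. $K$ is a field, $S=K[x_1,\dots,x_n,y_1,\dots,y_n]$, and vertices of $G$ are identified with variables of $S$. The edge ideal $I(G)$ is generated by the products of the endpoints of edges of $G$; the cover ideal $I(G)^\vee$ is generated by the monomials $\prod_{z\in C}z$, $C$ a minimal vertex cover of $G$. $G$ is unmixed if all minimal vertex covers have the same cardinality; $G$ is very well-covered if it is unmixed, has no isolated vertices, and $2\,\mathrm{height}(I(G))=|V(G)|$; $G$ is Cohen--Macaulay if $S/I(G)$ is a Cohen--Macaulay ring. Standard labelling: a Cohen--Macaulay very well-covered graph with $2n$ vertices always admits a labelling $V(G)=\{x_1,\dots,x_n,y_1,\dots,y_n\}$ such that: (i) $X=\{x_1,\dots,x_n\}$ is a minimal vertex cover and $Y=\{y_1,\dots,y_n\}$ is a maximal independent set; (ii) $x_iy_i\in E(G)$ for all $i$; (iii) if $x_iy_j\in E(G)$ then $i\le j$; (iv) if $x_iy_j\in E(G)$ then $x_ix_j\notin E(G)$; (v) if $z_ix_j,\,y_jx_k\in E(G)$ then $z_ix_k\in E(G)$, for any distinct $i,j,k$ and $z_i\in\{x_i,y_i\}$. Any labelling satisfying (i)--(v) is called standard. $\mathcal C(G)$ is the set of minimal vertex covers of $G$. For $C\in\mathcal C(G)$, $\mathcal C(G;C)=\{x_s: y_s\in C\text{ and }(C\setminus y_s)\cup x_s\in\mathcal C(G)\}$. For $C\subseteq V(G)$, $\mathbf z_C=\prod_{z\in C}z$; for a set $\sigma$ of $x$-variables, $\mathbf x_\sigma=\prod_{x_s\in\sigma}x_s$,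 with $\mathbf x_\emptyset=1$. Here $C\setminus y_s$ and $C\cup x_s$ mean $C\setminus\{y_s\}$ and $C\cup\{x_s\}$. *)

theory Defs
  imports
    "HOL-Algebra.Ideal"
    "HOL-Algebra.QuotRing"
    "HOL-Algebra.Ring_Divisibility"
    "HOL-Algebra.Module"
    "HOL-Library.Poly_Mapping"
    "HOL-Library.Extended_Nat"
begin

section \<open>Cohen--Macaulay rings\<close>

definition prime_chain :: "('a, 'm) ring_scheme \<Rightarrow> 'a set list \<Rightarrow> bool" where
  "prime_chain R Ps \<longleftrightarrow>
     Ps \<noteq> [] \<and> (\<forall>P \<in> set Ps. primeideal P R) \<and> sorted_wrt (\<subset>) Ps"

definition krull_dim :: "('a, 'm) ring_scheme \<Rightarrow> enat" where
  "krull_dim R = Sup {enat (length Ps - 1) | Ps. prime_chain R Ps}"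

definition height_prime :: "('a, 'm) ring_scheme \<Rightarrow> 'a set \<Rightarrow> enat" where
  "height_prime R P = Sup {enat (length Ps - 1) | Ps. prime_chain R Ps \<and> last Ps = P}"

definition height :: "('a, 'm) ring_scheme \<Rightarrow> 'a set \<Rightarrow> enat" where
  "height R I = Inf {height_prime R P | P. primeideal P R \<and> I \<subseteq> P}"

definition regular_sequence :: "('a, 'm) ring_scheme \<Rightarrow> 'a list \<Rightarrow> bool" where
  "regular_sequence R as \<longleftrightarrow>
     set as \<subseteq> carrier R \<and>
     Idl\<^bsub>R\<^esub> (set as) \<noteq> carrier R \<and>
     (\<forall>i < length as. \<forall>r \<in> carrier R.
        as ! i \<otimes>\<^bsub>R\<^esub> r \<in> Idl\<^bsub>R\<^esub> (set (take i as)) \<longrightarrow> r \<in> Idl\<^bsub>R\<^esub> (set (take i as)))"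

definition depth :: "('a, 'm) ring_scheme \<Rightarrow> 'a set \<Rightarrow> enat" where
  "depth R I = Sup {enat (length as) | as. set as \<subseteq> I \<and> regular_sequence R as}"

text \<open>
  \<open>loc_frac R U a s\<close> is the fraction \<open>a/s\<close>, i.e. the equivalence class of the pair \<open>(a, s)\<close>.
  The operations of \<open>localization R U\<close> are the unions over all representatives; on
  fractions they are the usual \<open>(a/s)(b/t) = ab/st\<close> and \<open>a/s + b/t = (at + bs)/st\<close>.
\<close>

definition loc_frac :: "('a, 'm) ring_scheme \<Rightarrow> 'a set \<Rightarrow> 'a \<Rightarrow> 'a \<Rightarrow> ('a \<times> 'a) set" where
  "loc_frac R U a s =
     {(b, t). b \<in> carrier R \<and> t \<in> U \<and>
        (\<exists>u \<in> U. u \<otimes>\<^bsub>R\<^esub> (t \<otimes>\<^bsub>R\<^esub> a \<ominus>\<^bsub>R\<^esub> s \<otimes>\<^bsub>R\<^esub> b) = \<zero>\<^bsub>R\<^esub>)}"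

definition localization :: "('a, 'm) ring_scheme \<Rightarrow> 'a set \<Rightarrow> ('a \<times> 'a) set ring" where
  "localization R U =
     \<lparr>carrier = {loc_frac R U a s | a s. a \<in> carrier R \<and> s \<in> U},
      mult = (\<lambda>A B. \<Union>(a, s) \<in> A. \<Union>(b, t) \<in> B. loc_frac R U (a \<otimes>\<^bsub>R\<^esub> b) (s \<otimes>\<^bsub>R\<^esub> t)),
      one = loc_frac R U \<one>\<^bsub>R\<^esub> \<one>\<^bsub>R\<^esub>,
      zero = loc_frac R U \<zero>\<^bsub>R\<^esub> \<one>\<^bsub>R\<^esub>,
      add = (\<lambda>A B. \<Union>(a, s) \<in> A. \<Union>(b, t) \<in> B.
               loc_frac R U (a \<otimes>\<^bsub>R\<^esub> t \<oplus>\<^bsub>R\<^esub> b \<otimes>\<^bsub>R\<^esub> s) (s \<otimes>\<^bsub>R\<^esub> t))\<rparr>"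

definition cohen_macaulay_local :: "('a, 'm) ring_scheme \<Rightarrow> bool" where
  "cohen_macaulay_local R \<longleftrightarrow>
     cring R \<and> noetherian_ring R \<and> (\<exists>!M. maximalideal M R) \<and>
     (\<forall>M. maximalideal M R \<longrightarrow> depth R M = krull_dim R)"

definition cohen_macaulay :: "('a, 'm) ring_scheme \<Rightarrow> bool" where
  "cohen_macaulay R \<longleftrightarrow>
     cring R \<and> noetherian_ring R \<and>
     (\<forall>M. maximalideal M R \<longrightarrow> cohen_macaulay_local (localization R (carrier R - M)))"


section \<open>Polynomial rings\<close>

text \<open>
  Monomials are exponent vectors \<open>'v \<Rightarrow>\<^sub>0 nat\<close>; they also serve as multidegrees.
  \<open>poly_ring V\<close> is the polynomial ring whose set of variables is \<open>V\<close>.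
\<close>

type_synonym 'v monomial = "'v \<Rightarrow>\<^sub>0 nat"
type_synonym ('v, 'k) mpoly = "'v monomial \<Rightarrow>\<^sub>0 'k"

definition poly_ring :: "'v set \<Rightarrow> ('v, 'k::field) mpoly ring" where
  "poly_ring V =
     \<lparr>carrier = {p. \<forall>m \<in> Poly_Mapping.keys p. Poly_Mapping.keys m \<subseteq> V},
      mult = (*), one = 1, zero = 0, add = (+)\<rparr>"

definition pvar :: "'v \<Rightarrow> ('v, 'k::field) mpoly" where
  "pvar z = Poly_Mapping.single (Poly_Mapping.single z 1) 1"

definition pprod :: "'v set \<Rightarrow> ('v, 'k::field) mpoly" where
  "pprod C = (\<Prod>z \<in> C. pvar z)"

definition mdeg_prod :: "'v set \<Rightarrow> 'v monomial" where
  "mdeg_prod C = (\<Sum>z \<in> C. Poly_Mapping.single z 1)"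


section \<open>Minimal multigraded free resolutions\<close>

text \<open>
  The free module with basis \<open>B\<close>, as coefficient functions vanishing outside \<open>B\<close>.
  The fields \<open>mult\<close> and \<open>one\<close> of the module record have no meaning for a module.
\<close>

definition free_module :: "('a, 'm) ring_scheme \<Rightarrow> 'b set \<Rightarrow> ('a, 'b \<Rightarrow> 'a) module" where
  "free_module R B =
     \<lparr>carrier = {v. (\<forall>b \<in> B. v b \<in> carrier R) \<and> (\<forall>b. b \<notin> B \<longrightarrow> v b = \<zero>\<^bsub>R\<^esub>) \<and>
                    finite {b. v b \<noteq> \<zero>\<^bsub>R\<^esub>}},
      mult = undefined, one = undefined,
      zero = (\<lambda>_. \<zero>\<^bsub>R\<^esub>), add = (\<lambda>u v b. u b \<oplus>\<^bsub>R\<^esub> v b),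
      smult = (\<lambda>r v b. r \<otimes>\<^bsub>R\<^esub> v b)\<rparr>"

definition ideal_module :: "('a, 'm) ring_scheme \<Rightarrow> 'a set \<Rightarrow> ('a, 'a) module" where
  "ideal_module R J =
     \<lparr>carrier = J, mult = undefined, one = undefined,
      zero = \<zero>\<^bsub>R\<^esub>, add = (\<oplus>\<^bsub>R\<^esub>), smult = (\<otimes>\<^bsub>R\<^esub>)\<rparr>"

definition linear_map ::
  "('a, 'm) ring_scheme \<Rightarrow> ('a, 'b) module \<Rightarrow> ('a, 'c) module \<Rightarrow> ('b \<Rightarrow> 'c) \<Rightarrow> bool" where
  "linear_map R M N f \<longleftrightarrow>
     f \<in> carrier M \<rightarrow> carrier N \<and>
     (\<forall>u \<in> carrier M. \<forall>v \<in> carrier M. f (u \<oplus>\<^bsub>M\<^esub> v) = f u \<oplus>\<^bsub>N\<^esub> f v) \<and>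
     (\<forall>r \<in> carrier R. \<forall>u \<in> carrier M. f (r \<odot>\<^bsub>M\<^esub> u) = r \<odot>\<^bsub>N\<^esub> f u)"

text \<open>
  \<open>hom_poly m p\<close>: the polynomial \<open>p\<close> is multihomogeneous of multidegree \<open>m\<close>.
  \<open>hom_vec mdeg m v\<close>: the same for an element \<open>v\<close> of a free module whose basis
  element \<open>b\<close> has multidegree \<open>mdeg b\<close>. Zero is homogeneous of every multidegree.
\<close>

definition hom_poly :: "'v monomial \<Rightarrow> ('v, 'k::field) mpoly \<Rightarrow> bool" where
  "hom_poly m p \<longleftrightarrow> Poly_Mapping.keys p \<subseteq> {m}"

definition hom_vec ::
  "('b \<Rightarrow> 'v monomial) \<Rightarrow> 'v monomial \<Rightarrow> ('b \<Rightarrow> ('v, 'k::field) mpoly) \<Rightarrow> bool" where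
  "hom_vec mdeg m v \<longleftrightarrow> (\<forall>b. \<forall>t \<in> Poly_Mapping.keys (v b). t + mdeg b = m)"

text \<open>
  The modules are \<open>F i = free_module S (B i)\<close> over \<open>S = poly_ring V\<close>, the maps are
  \<open>d i : F i \<rightarrow> F (i - 1)\<close> for \<open>i > 0\<close> (\<open>d 0\<close> is not used) and the augmentation
  \<open>\<epsilon> : F 0 \<rightarrow> J\<close>. Exactness everywhere includes that composites are zero. The last
  conjunct is minimality: \<open>d i\<close> maps \<open>F i\<close> into \<open>\<mm> F (i - 1)\<close>, where \<open>\<mm>\<close>
  is the ideal generated by the variables.
\<close>

definition minimal_multigraded_free_resolution ::
  "'v set \<Rightarrow> ('v, 'k::field) mpoly set \<Rightarrow>
   (nat \<Rightarrow> 'b set) \<Rightarrow> (nat \<Rightarrow> 'b \<Rightarrow> 'v monomial) \<Rightarrow>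
   (nat \<Rightarrow> ('b \<Rightarrow> ('v, 'k) mpoly) \<Rightarrow> 'b \<Rightarrow> ('v, 'k) mpoly) \<Rightarrow>
   (('b \<Rightarrow> ('v, 'k) mpoly) \<Rightarrow> ('v, 'k) mpoly) \<Rightarrow> bool" where
  "minimal_multigraded_free_resolution V J B mdeg d \<epsilon> \<longleftrightarrow>
     (let S = poly_ring V; F = (\<lambda>i. free_module S (B i)) in
       ideal J S \<and>
       (\<forall>i. finite (B i)) \<and>
       linear_map S (F 0) (ideal_module S J) \<epsilon> \<and>
       (\<forall>i > 0. linear_map S (F i) (F (i - 1)) (d i)) \<and>
       (\<forall>m. \<forall>v \<in> carrier (F 0). hom_vec (mdeg 0) m v \<longrightarrow> hom_poly m (\<epsilon> v)) \<and>
       (\<forall>i > 0. \<forall>m. \<forall>v \<in> carrier (F i).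
          hom_vec (mdeg i) m v \<longrightarrow> hom_vec (mdeg (i - 1)) m (d i v)) \<and>
       \<epsilon> ` carrier (F 0) = J \<and>
       {v \<in> carrier (F 0). \<epsilon> v = \<zero>\<^bsub>S\<^esub>} = d 1 ` carrier (F 1) \<and>
       (\<forall>i > 0. {v \<in> carrier (F i). d i v = \<zero>\<^bsub>F (i - 1)\<^esub>}
                 = d (i + 1) ` carrier (F (i + 1))) \<and>
       (\<forall>i > 0. \<forall>v \<in> carrier (F i). \<forall>b \<in> B (i - 1).
          d i v b \<in> Idl\<^bsub>S\<^esub> (pvar ` V)))"


section \<open>Graphs, edge ideals and cover ideals\<close>

definition simple_graph :: "'v set \<Rightarrow> 'v set set \<Rightarrow> bool" where
  "simple_graph V E \<longleftrightarrow> finite V \<and> (\<forall>e \<in> E. e \<subseteq> V \<and> card e = 2)"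

definition vertex_cover :: "'v set \<Rightarrow> 'v set set \<Rightarrow> 'v set \<Rightarrow> bool" where
  "vertex_cover V E C \<longleftrightarrow> C \<subseteq> V \<and> (\<forall>e \<in> E. e \<inter> C \<noteq> {})"

definition minimal_covers :: "'v set \<Rightarrow> 'v set set \<Rightarrow> 'v set set" where
  "minimal_covers V E = {C. vertex_cover V E C \<and> (\<forall>D. D \<subset> C \<longrightarrow> \<not> vertex_cover V E D)}"

definition independent_set :: "'v set \<Rightarrow> 'v set set \<Rightarrow> 'v set \<Rightarrow> bool" where
  "independent_set V E A \<longleftrightarrow> A \<subseteq> V \<and> (\<forall>e \<in> E. \<not> e \<subseteq> A)"

definition maximal_independent_sets :: "'v set \<Rightarrow> 'v set set \<Rightarrow> 'v set set" where
  "maximal_independent_sets V E =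
     {A. independent_set V E A \<and> (\<forall>D. A \<subset> D \<longrightarrow> \<not> independent_set V E D)}"

definition edge_ideal :: "'v set \<Rightarrow> 'v set set \<Rightarrow> ('v, 'k::field) mpoly set" where
  "edge_ideal V E = Idl\<^bsub>poly_ring V\<^esub> (pprod ` E)"

definition cover_ideal :: "'v set \<Rightarrow> 'v set set \<Rightarrow> ('v, 'k::field) mpoly set" where
  "cover_ideal V E = Idl\<^bsub>poly_ring V\<^esub> (pprod ` minimal_covers V E)"

definition unmixed_graph :: "'v set \<Rightarrow> 'v set set \<Rightarrow> bool" where
  "unmixed_graph V E \<longleftrightarrow>
     (\<forall>C \<in> minimal_covers V E. \<forall>D \<in> minimal_covers V E. card C = card D)"

text \<open>
  The type argument of the next two predicates is the coefficient field \<open>K\<close>, which occurs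
  in the height of the edge ideal and in the quotient of the polynomial ring by it.
\<close>

definition very_well_covered :: "'k::field itself \<Rightarrow> 'v set \<Rightarrow> 'v set set \<Rightarrow> bool" where
  "very_well_covered K V E \<longleftrightarrow>
     unmixed_graph V E \<and> (\<forall>v \<in> V. \<exists>e \<in> E. v \<in> e) \<and>
     2 * height (poly_ring V) (edge_ideal V E :: ('v, 'k) mpoly set) = enat (card V)"

definition cohen_macaulay_graph :: "'k::field itself \<Rightarrow> 'v set \<Rightarrow> 'v set set \<Rightarrow> bool" where
  "cohen_macaulay_graph K V E \<longleftrightarrow>
     cohen_macaulay (poly_ring V Quot (edge_ideal V E :: ('v, 'k) mpoly set))"


section \<open>Standard labellings\<close>

datatype vertex = X nat | Y nat

definition xvertices :: "nat \<Rightarrow> vertex set" where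
  "xvertices n = X ` {1..n}"

definition yvertices :: "nat \<Rightarrow> vertex set" where
  "yvertices n = Y ` {1..n}"

definition vertices :: "nat \<Rightarrow> vertex set" where
  "vertices n = xvertices n \<union> yvertices n"

definition standard_labelling :: "nat \<Rightarrow> vertex set set \<Rightarrow> bool" where
  "standard_labelling n E \<longleftrightarrow>
     xvertices n \<in> minimal_covers (vertices n) E \<and>
     yvertices n \<in> maximal_independent_sets (vertices n) E \<and>
     (\<forall>i \<in> {1..n}. {X i, Y i} \<in> E) \<and>
     (\<forall>i \<in> {1..n}. \<forall>j \<in> {1..n}. {X i, Y j} \<in> E \<longrightarrow> i \<le> j) \<and>
     (\<forall>i \<in> {1..n}. \<forall>j \<in> {1..n}. {X i, Y j} \<in> E \<longrightarrow> {X i, X j} \<notin> E) \<and>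
     (\<forall>i \<in> {1..n}. \<forall>j \<in> {1..n}. \<forall>k \<in> {1..n}. \<forall>z \<in> {X i, Y i}.
        i \<noteq> j \<and> j \<noteq> k \<and> i \<noteq> k \<and> {z, X j} \<in> E \<and> {Y j, X k} \<in> E \<longrightarrow> {z, X k} \<in> E)"


section \<open>The complex\<close>

definition swap :: "vertex set \<Rightarrow> nat \<Rightarrow> vertex set" where
  "swap C s = (C - {Y s}) \<union> {X s}"

definition swappable :: "nat \<Rightarrow> vertex set set \<Rightarrow> vertex set \<Rightarrow> vertex set" where
  "swappable n E C =
     {X s | s. s \<in> {1..n} \<and> Y s \<in> C \<and> swap C s \<in> minimal_covers (vertices n) E}"

text \<open>The pair \<open>(C, \<sigma>)\<close> stands for the basis symbol \<open>\<f>(C; \<sigma>)\<close>.\<close>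

definition res_basis :: "nat \<Rightarrow> vertex set set \<Rightarrow> nat \<Rightarrow> (vertex set \<times> vertex set) set" where
  "res_basis n E i =
     {(C, \<sigma>). C \<in> minimal_covers (vertices n) E \<and> \<sigma> \<subseteq> swappable n E C \<and> card \<sigma> = i}"

definition res_mdeg :: "nat \<Rightarrow> vertex set \<times> vertex set \<Rightarrow> vertex monomial" where
  "res_mdeg i = (\<lambda>(C, \<sigma>). mdeg_prod C + mdeg_prod \<sigma>)"

definition alpha :: "vertex set \<Rightarrow> nat \<Rightarrow> nat" where
  "alpha \<sigma> s = card {j. X j \<in> \<sigma> \<and> j > s}"

definition unit_vec :: "'b \<Rightarrow> 'b \<Rightarrow> ('v, 'k::field) mpoly" where
  "unit_vec b = (\<lambda>b'. if b' = b then 1 else 0)"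

definition res_bdry ::
  "vertex set \<times> vertex set \<Rightarrow> vertex set \<times> vertex set \<Rightarrow> (vertex, 'k::field) mpoly" where
  "res_bdry = (\<lambda>(C, \<sigma>) b. \<Sum>s | X s \<in> \<sigma>. (-1) ^ alpha \<sigma> s *
     (pvar (Y s) * unit_vec (swap C s, \<sigma> - {X s}) b
      - pvar (X s) * unit_vec (C, \<sigma> - {X s}) b))"

text \<open>The linear extensions of the values on basis symbols.\<close>

definition res_diff ::
  "nat \<Rightarrow> vertex set set \<Rightarrow> nat \<Rightarrow> (vertex set \<times> vertex set \<Rightarrow> (vertex, 'k::field) mpoly) \<Rightarrow>
   vertex set \<times> vertex set \<Rightarrow> (vertex, 'k) mpoly" where
  "res_diff n E i v = (\<lambda>b. \<Sum>c \<in> res_basis n E i. v c * res_bdry c b)"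

definition res_aug ::
  "nat \<Rightarrow> vertex set set \<Rightarrow> (vertex set \<times> vertex set \<Rightarrow> (vertex, 'k::field) mpoly) \<Rightarrow>
   (vertex, 'k) mpoly" where
  "res_aug n E v = (\<Sum>c \<in> res_basis n E 0. v c * pprod (fst c))"

end

theory Submission
  imports Defs
begin

text \<open>
  By unmixedness a minimal cover contains exactly one of \<open>X i\<close>, \<open>Y i\<close>, so a cover is
  determined by its set of \<open>Y\<close>'s, and the symbols \<open>(C, \<sigma>)\<close> are the cells of a cube
  complex: from \<open>C\<close> the \<open>Y s\<close> with \<open>X s \<in> \<sigma>\<close> may be exchanged for \<open>X s\<close> independently of each
  other. In a fixed multidegree \<open>m\<close> the complex becomes the augmented chain complex of the cells
  \<open>(C, \<sigma>)\<close> with \<open>C \<union> \<sigma>\<close> inside the support of \<open>m\<close>. The covers inside this support are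
  closed under intersecting their \<open>Y\<close>-parts, so there is a bottom one, and every other one can
  be moved towards it by swapping its first superfluous \<open>Y t\<close> (this uses that \<open>{X i, Y j} \<in> E\<close>
  implies \<open>i \<le> j\<close>). The choice of \<open>t\<close> depends on \<open>C\<close> only, hence defines an acyclic
  matching whose single critical cell is the bottom cover, which gives exactness over any
  coefficient ring.
\<close>

section \<open>Minimal covers of a standardly labelled unmixed graph\<close>

text \<open>Compares a minimal cover with \<open>{1..n}\<close>: by cardinality this map turns out
  to be bijective on it.\<close>

fun vertex_index :: "vertex \<Rightarrow> nat" where
  "vertex_index (X i) = i"
| "vertex_index (Y i) = i"

lemma X_in_vertices [simp]: "X i \<in> vertices n \<longleftrightarrow> i \<in> {1..n}"
  and Y_in_vertices [simp]: "Y i \<in> vertices n \<longleftrightarrow> i \<in> {1..n}"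
  by (auto simp: vertices_def xvertices_def yvertices_def)

lemma finite_vertices [simp]: "finite (vertices n)"
  by (simp add: vertices_def xvertices_def yvertices_def)

lemma vertices_cases:
  assumes "z \<in> vertices n"
  obtains i where "i \<in> {1..n}" "z = X i" | i where "i \<in> {1..n}" "z = Y i"
  using assms by (auto simp: vertices_def xvertices_def yvertices_def)

lemma swap_iff [simp]:
  "X i \<in> swap C s \<longleftrightarrow> X i \<in> C \<or> i = s"
  "Y i \<in> swap C s \<longleftrightarrow> Y i \<in> C \<and> i \<noteq> s"
  by (auto simp: swap_def)

text \<open>A rank on covers: exchanges lower it, and the induction for exactness descends along
  it.\<close>

definition y_count :: "vertex set \<Rightarrow> nat" where
  "y_count C = card {j. Y j \<in> C}"

lemma finite_y_indices: "C \<subseteq> vertices n \<Longrightarrow> finite {j. Y j \<in> C}"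
  by (rule finite_subset[of _ "{1..n}"]) (auto dest: subsetD)

lemma y_count_swap:
  assumes "C \<subseteq> vertices n" "Y s \<in> C"
  shows "y_count (swap C s) < y_count C"
  unfolding y_count_def using assms finite_y_indices[OF assms(1)]
  by (intro psubset_card_mono) auto

locale unmixed_standard_graph =
  fixes n :: nat and E :: "vertex set set"
  assumes graph: "simple_graph (vertices n) E"
    and unmixed: "unmixed_graph (vertices n) E"
    and labelling: "standard_labelling n E"
begin

abbreviation covers :: "vertex set set" where
  "covers \<equiv> minimal_covers (vertices n) E"

lemma diagonal_edge: "i \<in> {1..n} \<Longrightarrow> {X i, Y i} \<in> E"
  using labelling unfolding standard_labelling_def by blast

text \<open>Independence of the \<open>Y\<close> vertices excludes edges between two of them, and
  the ordering condition of a standard labelling gives \<open>i \<le> j\<close> in the mixed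
  case.\<close>

lemma edge_cases:
  assumes "e \<in> E"
  obtains i j where "i \<in> {1..n}" "j \<in> {1..n}" "e = {X i, X j}"
  | i j where "i \<in> {1..n}" "j \<in> {1..n}" "i \<le> j" "e = {X i, Y j}"
proof -
  have "e \<subseteq> vertices n" "card e = 2"
    using graph assms by (auto simp: simple_graph_def)
  then obtain u v where uv: "e = {u, v}" "u \<in> vertices n" "v \<in> vertices n"
    by (auto simp: card_2_iff)
  have le: "i \<le> j" if "i \<in> {1..n}" "j \<in> {1..n}" "{X i, Y j} \<in> E" for i j
    using labelling that unfolding standard_labelling_def by blast
  have "yvertices n \<in> maximal_independent_sets (vertices n) E"
    using labelling unfolding standard_labelling_def by blast
  then have "\<not> e \<subseteq> yvertices n"
    using assms by (auto simp: maximal_independent_sets_def independent_set_def)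
  then have YY: "\<not> (u = Y i \<and> v = Y j)" for i j
    using uv by (auto simp: yvertices_def)
  show thesis
    using uv(2)
  proof (cases rule: vertices_cases)
    case (1 i)
    show thesis
      using uv(3)
    proof (cases rule: vertices_cases)
      case (1 j)
      then show thesis using that(1)[of i j] \<open>i \<in> {1..n}\<close> \<open>u = X i\<close> uv by auto
    next
      case (2 j)
      then show thesis using that(2)[of i j] \<open>i \<in> {1..n}\<close> \<open>u = X i\<close> uv le[of i j] assms by auto
    qed
  next
    case (2 i)
    show thesis
      using uv(3)
    proof (cases rule: vertices_cases)
      case (1 j)
      then show thesis
        using that(2)[of j i] \<open>i \<in> {1..n}\<close> \<open>u = Y i\<close> uv le[of j i] assms
        by (auto simp: insert_commute)
    next
      case (2 j)
      then show thesis using YY \<open>u = Y i\<close> by auto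
    qed
  qed
qed

text \<open>The diagonal edges make \<open>vertex_index\<close> map a minimal cover onto
  \<open>{1..n}\<close>; the cover has only \<open>n\<close> elements, so the map is injective and
  exactly one end of each diagonal edge is used. Conversely, a proper subset of such a cover misses
  some diagonal edge completely.\<close>

lemma minimal_cover_iff:
  "C \<in> covers \<longleftrightarrow>
     vertex_cover (vertices n) E C \<and> (\<forall>i \<in> {1..n}. X i \<in> C \<longleftrightarrow> Y i \<notin> C)"
proof
  assume C: "C \<in> covers"
  then have cover: "vertex_cover (vertices n) E C" by (simp add: minimal_covers_def)
  then have sub: "C \<subseteq> vertices n" by (simp add: vertex_cover_def)
  have "xvertices n \<in> covers" using labelling unfolding standard_labelling_def by blast
  \<comment> \<open>Unmixedness enters here: the minimal cover formed by all \<open>X i\<close>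
    fixes the common size \<open>n\<close>.\<close>
  then have "card C = card (xvertices n)" using unmixed C unfolding unmixed_graph_def by blast
  then have card: "card C = n" by (simp add: xvertices_def card_image inj_on_def)
  have diag: "X i \<in> C \<or> Y i \<in> C" if "i \<in> {1..n}" for i
  proof -
    have "{X i, Y i} \<inter> C \<noteq> {}"
      using cover diagonal_edge[OF that] unfolding vertex_cover_def by (elim conjE) (rule bspec)
    then show ?thesis by blast
  qed
  have "vertex_index ` C = {1..n}"
  proof
    show "vertex_index ` C \<subseteq> {1..n}"
    proof
      fix i assume "i \<in> vertex_index ` C"
      then obtain z where "z \<in> vertices n" "i = vertex_index z" using sub by blast
      then show "i \<in> {1..n}" by (elim vertices_cases) simp_all
    qed
    show "{1..n} \<subseteq> vertex_index ` C"
    proof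
      fix i assume "i \<in> {1..n}"
      then show "i \<in> vertex_index ` C"
        using diag[of i] by (metis vertex_index.simps imageI)
    qed
  qed
  then have "inj_on vertex_index C"
    using card finite_subset[OF sub] by (intro eq_card_imp_inj_on) auto
  then have "\<not> (X i \<in> C \<and> Y i \<in> C)" for i
    using inj_onD[of vertex_index C "X i" "Y i"] by auto
  then show "vertex_cover (vertices n) E C \<and> (\<forall>i \<in> {1..n}. X i \<in> C \<longleftrightarrow> Y i \<notin> C)"
    using cover diag by blast
next
  assume C: "vertex_cover (vertices n) E C \<and> (\<forall>i \<in> {1..n}. X i \<in> C \<longleftrightarrow> Y i \<notin> C)"
  have "\<not> vertex_cover (vertices n) E D" if DC: "D \<subset> C" for D
  proof
    assume D: "vertex_cover (vertices n) E D"
    obtain z where z: "z \<in> C" "z \<notin> D" using DC by blast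
    then have "z \<in> vertices n" using C by (auto simp: vertex_cover_def)
    then obtain i where i: "i \<in> {1..n}" "z = X i \<or> z = Y i" by (auto elim: vertices_cases)
    have "{X i, Y i} \<inter> D \<noteq> {}"
      using D diagonal_edge[OF i(1)] unfolding vertex_cover_def by (elim conjE) (rule bspec)
    then show False using C z i DC by auto
  qed
  then show "C \<in> covers" using C by (auto simp: minimal_covers_def)
qed

lemma covers_subset: "C \<in> covers \<Longrightarrow> C \<subseteq> vertices n"
  by (simp add: minimal_covers_def vertex_cover_def)

lemma finite_covers: "finite covers"
  by (rule finite_subset[of _ "Pow (vertices n)"]) (auto dest: covers_subset)

lemma covers_X_iff: "C \<in> covers \<Longrightarrow> i \<in> {1..n} \<Longrightarrow> X i \<in> C \<longleftrightarrow> Y i \<notin> C"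
  by (simp add: minimal_cover_iff)

lemma covers_edge:
  assumes "C \<in> covers" "{u, v} \<in> E"
  shows "u \<in> C \<or> v \<in> C"
proof -
  have "\<forall>e \<in> E. e \<inter> C \<noteq> {}" using assms(1) by (simp add: minimal_cover_iff vertex_cover_def)
  then have "{u, v} \<inter> C \<noteq> {}" using assms(2) by (rule bspec)
  then show ?thesis by blast
qed

lemma coversI:
  assumes "C \<subseteq> vertices n"
    and "\<And>i. i \<in> {1..n} \<Longrightarrow> X i \<in> C \<longleftrightarrow> Y i \<notin> C"
    and "\<And>i j. {X i, X j} \<in> E \<Longrightarrow> i \<in> {1..n} \<Longrightarrow> j \<in> {1..n} \<Longrightarrow> X i \<in> C \<or> X j \<in> C"
    and "\<And>i j. {X i, Y j} \<in> E \<Longrightarrow> i \<in> {1..n} \<Longrightarrow> j \<in> {1..n} \<Longrightarrow> i \<le> j \<Longrightarrow> X i \<in> C \<or> Y j \<in> C"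
  shows "C \<in> covers"
proof -
  have "e \<inter> C \<noteq> {}" if "e \<in> E" for e
    using that
  proof (cases rule: edge_cases)
    case (1 i j)
    then show ?thesis using assms(3)[of i j] that by auto
  next
    case (2 i j)
    then show ?thesis using assms(4)[of i j] that by auto
  qed
  then show ?thesis using assms(1,2) by (simp add: minimal_cover_iff vertex_cover_def)
qed

lemma covers_eqI:
  assumes "C \<in> covers" "D \<in> covers" and eq: "\<And>i. Y i \<in> C \<longleftrightarrow> Y i \<in> D"
  shows "C = D"
proof -
  have "X i \<in> C \<longleftrightarrow> X i \<in> D" for i
    using assms covers_X_iff covers_subset X_in_vertices by (metis subsetD)
  then show ?thesis using eq by (metis vertex.exhaust subsetI subset_antisym)
qed

section \<open>Admissible exchanges in a minimal cover\<close>

lemma swappable_iff: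
  "X s \<in> swappable n E C \<longleftrightarrow> s \<in> {1..n} \<and> Y s \<in> C \<and> swap C s \<in> covers"
  by (auto simp: swappable_def)

lemma swappable_subset: "swappable n E C \<subseteq> X ` {1..n}"
  by (auto simp: swappable_def)

lemma swappable_subset_vertices: "swappable n E C \<subseteq> vertices n"
  using swappable_subset by fastforce

lemma finite_swappable: "finite (swappable n E C)"
  using finite_subset[OF swappable_subset] by simp

lemma swappable_disjoint: "C \<in> covers \<Longrightarrow> C \<inter> swappable n E C = {}"
  using covers_X_iff by (auto simp: swappable_def)

text \<open>Exchanges are independent: if an edge \<open>{X i, Y j}\<close> does not get
  \<open>X i\<close> from the double swap, then each single swap must cover it by
  \<open>Y j\<close>, so \<open>Y j\<close> survives both.\<close>

lemma swappable_swap: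
  assumes C: "C \<in> covers" and s: "X s \<in> swappable n E C" and r: "X r \<in> swappable n E C"
    and "r \<noteq> s"
  shows "X r \<in> swappable n E (swap C s)"
proof -
  have sC: "swap C s \<in> covers" "s \<in> {1..n}" and rC: "swap C r \<in> covers" "r \<in> {1..n}" "Y r \<in> C"
    using s r by (auto simp: swappable_iff)
  have "swap (swap C s) r \<in> covers"
  proof (rule coversI)
    show "swap (swap C s) r \<subseteq> vertices n"
      using covers_subset[OF C] sC rC by (auto simp: swap_def)
    show "X i \<in> swap (swap C s) r \<longleftrightarrow> Y i \<notin> swap (swap C s) r" if "i \<in> {1..n}" for i
      using covers_X_iff[OF C that] by auto
    show "X i \<in> swap (swap C s) r \<or> X j \<in> swap (swap C s) r" if "{X i, X j} \<in> E" for i j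
      using covers_edge[OF C that] by auto
    show "X i \<in> swap (swap C s) r \<or> Y j \<in> swap (swap C s) r" if "{X i, Y j} \<in> E" for i j
      using covers_edge[OF sC(1) that] covers_edge[OF rC(1) that] by auto
  qed
  then show ?thesis using rC \<open>r \<noteq> s\<close> by (simp add: swappable_iff)
qed

text \<open>
  The covers below a given vertex set form a meet semilattice under the operation that
  intersects the \<open>Y\<close>-parts, so the cover with the fewest \<open>Y\<close>'s is their bottom element.
\<close>

lemma covers_meet:
  assumes C: "C \<in> covers" and D: "D \<in> covers"
  shows "(C \<inter> D) \<union> ((C \<union> D) \<inter> xvertices n) \<in> covers" (is "?M \<in> _")
proof (rule coversI)
  \<comment> \<open>Complementation turns the intersection of the \<open>Y\<close> parts into the
    union of the \<open>X\<close> parts, which explains the lopsided formula.\<close>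
  have mem: "X i \<in> ?M \<longleftrightarrow> X i \<in> C \<or> X i \<in> D" "Y i \<in> ?M \<longleftrightarrow> Y i \<in> C \<and> Y i \<in> D" for i
    using covers_subset[OF C] covers_subset[OF D] by (auto simp: xvertices_def)
  show "?M \<subseteq> vertices n" using covers_subset[OF C] covers_subset[OF D] by auto
  show "X i \<in> ?M \<longleftrightarrow> Y i \<notin> ?M" if "i \<in> {1..n}" for i
    using covers_X_iff[OF C that] covers_X_iff[OF D that] mem by blast
  show "X i \<in> ?M \<or> X j \<in> ?M" if "{X i, X j} \<in> E" for i j
    using covers_edge[OF C that] mem by blast
  show "X i \<in> ?M \<or> Y j \<in> ?M" if "{X i, Y j} \<in> E" for i j
    using covers_edge[OF C that] covers_edge[OF D that] mem by blast
qed

text \<open>\<open>D\<close> will be the support of a multidegree. An exchange inside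
  \<open>D\<close> would lower \<open>y_count\<close>, so the bottom cover admits none; any other
  cover contains the whole \<open>Y\<close> part of the bottom one, and its first surplus
  \<open>Y t\<close> can be exchanged.\<close>

lemma bottom_cover:
  assumes "C1 \<in> covers" "C1 \<subseteq> D"
  obtains C0 where "C0 \<in> covers" "C0 \<subseteq> D" "swappable n E C0 \<inter> D = {}"
    "\<forall>C \<in> covers. C \<subseteq> D \<longrightarrow> y_count C0 \<le> y_count C"
    "\<forall>C \<in> covers. C \<subseteq> D \<and> C \<noteq> C0 \<longrightarrow> (\<exists>t. X t \<in> swappable n E C \<inter> D)"
proof -
  obtain C0 where C0: "C0 \<in> covers" "C0 \<subseteq> D"
    and least: "\<And>C. C \<in> covers \<Longrightarrow> C \<subseteq> D \<Longrightarrow> y_count C0 \<le> y_count C"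
    using ex_has_least_nat[of "\<lambda>C. C \<in> covers \<and> C \<subseteq> D" C1 y_count] assms by blast
  have fin: "finite {j. Y j \<in> C0}" using finite_y_indices covers_subset[OF C0(1)] .
  have bottom: "Y i \<in> C" if "C \<in> covers" "C \<subseteq> D" "Y i \<in> C0" for C i
  proof -
    \<comment> \<open>The meet again lies in \<open>D\<close>, so minimality of
      \<open>y_count C0\<close> means that no element of the \<open>Y\<close> part of
      \<open>C0\<close> is lost.\<close>
    let ?M = "(C \<inter> C0) \<union> ((C \<union> C0) \<inter> xvertices n)"
    have "y_count C0 \<le> y_count ?M"
      using covers_meet[OF that(1) C0(1)] that(2) C0(2) by (intro least) auto
    moreover have "{j. Y j \<in> ?M} = {j. Y j \<in> C \<and> Y j \<in> C0}" by (auto simp: xvertices_def)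
    ultimately have "{j. Y j \<in> C \<and> Y j \<in> C0} = {j. Y j \<in> C0}"
      using fin by (intro card_seteq) (auto simp: y_count_def)
    then show ?thesis using that(3) by auto
  qed
  have empty: "swappable n E C0 \<inter> D = {}"
  proof (rule ccontr)
    assume "swappable n E C0 \<inter> D \<noteq> {}"
    then obtain s where s: "X s \<in> swappable n E C0" "X s \<in> D" by (auto simp: swappable_def)
    then have "swap C0 s \<in> covers" "Y s \<in> C0" by (auto simp: swappable_iff)
    moreover have "swap C0 s \<subseteq> D" using C0 s by (auto simp: swap_def)
    ultimately show False using least y_count_swap covers_subset[OF C0(1)] by (meson not_le)
  qed
  have ex: "\<exists>t. X t \<in> swappable n E C \<inter> D" if C: "C \<in> covers" "C \<subseteq> D" "C \<noteq> C0" for C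
  proof -
    have "\<exists>i. Y i \<in> C \<and> Y i \<notin> C0" using covers_eqI[OF C(1) C0(1)] bottom[OF C(1,2)] C(3) by blast
    \<comment> \<open>The least surplus index matters: an edge \<open>{X i, Y t}\<close> has
      \<open>i \<le> t\<close>, and below \<open>t\<close> every \<open>Y i\<close> of
      \<open>C\<close> is also in \<open>C0\<close>.\<close>
    define t where "t = (LEAST i. Y i \<in> C \<and> Y i \<notin> C0)"
    have t: "Y t \<in> C" "Y t \<notin> C0"
      using LeastI_ex[OF \<open>\<exists>i. Y i \<in> C \<and> Y i \<notin> C0\<close>] by (auto simp: t_def)
    have below: "Y i \<in> C0" if "Y i \<in> C" "i < t" for i
      using not_less_Least[of i "\<lambda>i. Y i \<in> C \<and> Y i \<notin> C0"] that by (auto simp: t_def)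
    have tn: "t \<in> {1..n}" using t(1) covers_subset[OF C(1)] Y_in_vertices by blast
    \<comment> \<open>\<open>C0\<close> omits \<open>Y t\<close>, so it contains \<open>X t\<close>,
      and \<open>C0\<close> lies in \<open>D\<close>.\<close>
    have "X t \<in> D" using covers_X_iff[OF C0(1) tn] t C0(2) by auto
    moreover have "swap C t \<in> covers"
    proof (rule coversI)
      show "swap C t \<subseteq> vertices n" using covers_subset[OF C(1)] tn by (auto simp: swap_def)
      show "X i \<in> swap C t \<longleftrightarrow> Y i \<notin> swap C t" if "i \<in> {1..n}" for i
        using covers_X_iff[OF C(1) that] by auto
      show "X i \<in> swap C t \<or> X j \<in> swap C t" if "{X i, X j} \<in> E" for i j
        using covers_edge[OF C(1) that] by auto
      show "X i \<in> swap C t \<or> Y j \<in> swap C t"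
        if "{X i, Y j} \<in> E" "i \<in> {1..n}" "j \<in> {1..n}" "i \<le> j" for i j
      proof (cases "j = t")
        \<comment> \<open>If \<open>X i\<close> is missing from \<open>C\<close> and
          \<open>i < t\<close>, then \<open>Y i\<close> lies in \<open>C\<close> and hence in
          \<open>C0\<close>; so \<open>C0\<close> has neither \<open>X i\<close> nor
          \<open>Y t\<close> and would not cover the edge.\<close>
        case True
        then have "X i \<in> C \<or> i = t"
          using below[of i] covers_X_iff[OF C(1) that(2)] covers_X_iff[OF C0(1) that(2)]
            covers_edge[OF C0(1) that(1)] t that(4) by auto
        then show ?thesis by auto
      next
        case False
        then show ?thesis using covers_edge[OF C(1) that(1)] by auto
      qed
    qed
    ultimately show ?thesis using t tn by (auto simp: swappable_iff)
  qed
  show thesis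
  proof (rule that[OF C0 empty])
    show "\<forall>C \<in> covers. C \<subseteq> D \<longrightarrow> y_count C0 \<le> y_count C" using least by blast
    show "\<forall>C \<in> covers. C \<subseteq> D \<and> C \<noteq> C0 \<longrightarrow> (\<exists>t. X t \<in> swappable n E C \<inter> D)"
      using ex by blast
  qed
qed

section \<open>Cells of the cube complex and their faces\<close>

lemma res_basis_iff:
  "(C, \<sigma>) \<in> res_basis n E i \<longleftrightarrow> C \<in> covers \<and> \<sigma> \<subseteq> swappable n E C \<and> card \<sigma> = i"
  by (simp add: res_basis_def)

lemma res_basis_finite_snd: "(C, \<sigma>) \<in> res_basis n E i \<Longrightarrow> finite \<sigma>"
  using finite_swappable finite_subset by (auto simp: res_basis_iff)

lemma finite_res_basis: "finite (res_basis n E i)"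
proof (rule finite_subset)
  show "res_basis n E i \<subseteq> covers \<times> Pow (vertices n)"
    using swappable_subset_vertices by (force simp: res_basis_iff)
qed (simp add: finite_covers)

text \<open>Closure under faces; for the swapped face the remaining exchanges stay admissible by
  \<open>swappable_swap\<close>.\<close>

lemma res_basis_face:
  assumes "(C, \<sigma>) \<in> res_basis n E (Suc i)" "X s \<in> \<sigma>"
  shows "(C, \<sigma> - {X s}) \<in> res_basis n E i" "(swap C s, \<sigma> - {X s}) \<in> res_basis n E i"
proof -
  have C: "C \<in> covers" "\<sigma> \<subseteq> swappable n E C" "card \<sigma> = Suc i"
    using assms(1) by (auto simp: res_basis_iff)
  have card: "card (\<sigma> - {X s}) = i" using C(3) assms(2) by simp
  then show "(C, \<sigma> - {X s}) \<in> res_basis n E i" using C by (auto simp: res_basis_iff)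
  have "\<sigma> - {X s} \<subseteq> swappable n E (swap C s)"
  proof
    fix z assume z: "z \<in> \<sigma> - {X s}"
    then obtain r where "z = X r" using C(2) swappable_subset by blast
    then show "z \<in> swappable n E (swap C s)" using swappable_swap[OF C(1)] C(2) z assms(2) by blast
  qed
  moreover have "swap C s \<in> covers" using C(2) assms(2) by (auto simp: swappable_iff)
  ultimately show "(swap C s, \<sigma> - {X s}) \<in> res_basis n E i" using card by (simp add: res_basis_iff)
qed

end

section \<open>The boundary map with constant coefficients\<close>

lemma finite_x_indices: "finite \<tau> \<Longrightarrow> finite {j. X j \<in> \<tau> \<and> P j}"
  by (rule finite_subset[OF _ finite_vimageI[of \<tau> X]]) (auto simp: inj_on_def)

lemma alpha_insert:
  assumes "finite \<tau>" "X r \<notin> \<tau>"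
  shows "alpha (insert (X r) \<tau>) s = alpha \<tau> s + (if s < r then 1 else 0)"
proof -
  have "{j. X j \<in> insert (X r) \<tau> \<and> s < j} =
      (if s < r then insert r {j. X j \<in> \<tau> \<and> s < j} else {j. X j \<in> \<tau> \<and> s < j})"
    by auto
  then show ?thesis using assms finite_x_indices by (simp add: alpha_def)
qed

text \<open>Inserting \<open>X r\<close> changes the exponent of \<open>s\<close> only when
  \<open>s < r\<close>, so exactly one of the two orders of removal picks up an extra sign. This is
  the sign rule behind the vanishing of composites.\<close>

lemma alpha_alternate:
  assumes "finite \<tau>" "X s \<notin> \<tau>" "X r \<notin> \<tau>" "r \<noteq> s"
  shows "(-1) ^ alpha \<tau> s * (-1) ^ alpha (insert (X s) \<tau>) r =
    - ((-1) ^ alpha \<tau> r * (-1) ^ alpha (insert (X r) \<tau>) s :: 'r::comm_ring_1)"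
  using assms by (auto simp: alpha_insert)

text \<open>Undoes \<open>swap\<close>; it is needed because \<open>bd\<close> looks from a face to
  the cells above it.\<close>

definition unswap :: "vertex set \<Rightarrow> nat \<Rightarrow> vertex set" where
  "unswap C s = (C - {X s}) \<union> {Y s}"

lemma unswap_iff [simp]:
  "X i \<in> unswap C s \<longleftrightarrow> X i \<in> C \<and> i \<noteq> s"
  "Y i \<in> unswap C s \<longleftrightarrow> Y i \<in> C \<or> i = s"
  by (auto simp: unswap_def)

lemma swap_unswap: "X s \<in> C \<Longrightarrow> Y s \<notin> C \<Longrightarrow> swap (unswap C s) s = C"
  by (auto simp: swap_def unswap_def)

lemma unswap_commute: "unswap (unswap C s) r = unswap (unswap C r) s"
  by (auto simp: unswap_def)

lemma y_count_unswap:
  assumes "C \<subseteq> vertices n" "Y s \<notin> C"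
  shows "y_count C < y_count (unswap C s)"
proof -
  have "{j. Y j \<in> unswap C s} = insert s {j. Y j \<in> C}" by auto
  then show ?thesis using assms finite_y_indices by (simp add: y_count_def)
qed

text \<open>
  \<open>slide s\<close> and \<open>bd\<close> act on coefficient functions: the value of \<open>bd n g\<close> at
  a cell collects \<open>g\<close> over all cells that have it as a face.
\<close>

definition slide :: "nat \<Rightarrow> (vertex set \<Rightarrow> 'r::comm_ring_1) \<Rightarrow> vertex set \<Rightarrow> 'r" where
  "slide s h C = (if X s \<in> C \<and> Y s \<notin> C then h (unswap C s) else 0) - h C"

definition bd ::
  "nat \<Rightarrow> (vertex set \<times> vertex set \<Rightarrow> 'r::comm_ring_1) \<Rightarrow> vertex set \<times> vertex set \<Rightarrow> 'r" where
  "bd n g = (\<lambda>(C, \<tau>). \<Sum>s | s \<in> {1..n} \<and> X s \<notin> \<tau>.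
     (-1) ^ alpha \<tau> s * slide s (\<lambda>C'. g (C', insert (X s) \<tau>)) C)"

lemma slide_linear:
  "slide s (\<lambda>C'. \<Sum>r \<in> A. a r * h r C') C = (\<Sum>r \<in> A. a r * slide s (h r) C)"
  by (cases "X s \<in> C \<and> Y s \<notin> C") (auto simp: slide_def sum_subtractf sum_negf right_diff_distrib)

lemma slide_commute:
  "r \<noteq> s \<Longrightarrow> slide s (slide r h) C = slide r (slide s h) C"
  by (auto simp: slide_def unswap_commute)

lemma slide_diff: "slide s (\<lambda>C'. h C' - k C') C = slide s h C - slide s k C"
  by (simp add: slide_def)

lemma bd_diff: "bd n (\<lambda>b. g b - h b) b = bd n g b - bd n h b"
  by (cases b) (simp add: bd_def slide_diff sum_subtractf right_diff_distrib)

lemma bd_zero: "bd n (\<lambda>b. 0) b = 0"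
  by (cases b) (simp add: bd_def slide_def)

text \<open>The terms with \<open>r < s\<close> cancel those with \<open>s < r\<close>. Deducing
  only that twice the sum vanishes would not suffice in characteristic 2.\<close>

lemma sum_alternating:
  fixes f :: "nat \<Rightarrow> nat \<Rightarrow> 'r::ab_group_add"
  assumes "finite A" and alt: "\<And>r s. r \<in> A \<Longrightarrow> s \<in> A \<Longrightarrow> r \<noteq> s \<Longrightarrow> f s r = - f r s"
  shows "(\<Sum>s \<in> A. \<Sum>r \<in> A - {s}. f s r) = 0"
proof -
  have split: "(\<Sum>r \<in> A - {s}. f s r) =
      (\<Sum>r \<in> A. if r < s then f s r else 0) + (\<Sum>r \<in> A. if s < r then f s r else 0)"
    if "s \<in> A" for s
  proof -
    have "(\<Sum>r \<in> A - {s}. f s r) = (\<Sum>r \<in> A. if r \<noteq> s then f s r else 0)"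
      using assms(1) by (intro sum.mono_neutral_cong_left) auto
    then show ?thesis by (simp add: sum.distrib[symmetric]) (auto intro!: sum.cong)
  qed
  have "(\<Sum>s \<in> A. \<Sum>r \<in> A. if r < s then f s r else 0) =
      (\<Sum>r \<in> A. \<Sum>s \<in> A. if r < s then f s r else 0)"
    by (rule sum.swap)
  also have "\<dots> = - (\<Sum>s \<in> A. \<Sum>r \<in> A. if s < r then f s r else 0)"
  proof -
    have "(if r < s then f s r else 0) = - (if r < s then f r s else 0)" if "r \<in> A" "s \<in> A" for r s
      using alt[of r s] that by simp
    then show ?thesis by (simp add: sum_negf cong: sum.cong)
  qed
  finally show ?thesis by (simp add: split sum.distrib)
qed

text \<open>Slides at distinct indices commute and the signs alternate, so the double sum over
  ordered pairs cancels. Finiteness of \<open>\<tau>\<close> makes the cardinalities in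
  \<open>alpha\<close> meaningful.\<close>

lemma bd_bd_finite:
  assumes "finite \<tau>"
  shows "bd n (bd n g) (C, \<tau>) = 0"
proof -
  define A where "A = {s. s \<in> {1..n} \<and> X s \<notin> \<tau>}"
  have "bd n (bd n g) (C, \<tau>) = (\<Sum>s \<in> A. \<Sum>r \<in> A - {s}.
      ((-1) ^ alpha \<tau> s * (-1) ^ alpha (insert (X s) \<tau>) r) *
      slide s (slide r (\<lambda>C'. g (C', insert (X r) (insert (X s) \<tau>)))) C)"
  proof -
    have A: "A - {s} = {r. r \<in> {1..n} \<and> X r \<notin> insert (X s) \<tau>}" for s
      by (auto simp: A_def)
    show ?thesis
      unfolding A by (simp add: bd_def A_def slide_linear sum_distrib_left mult.assoc)
  qed
  also have "\<dots> = 0"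
  proof (rule sum_alternating)
    show "finite A" by (simp add: A_def)
  next
    fix r s assume rs: "r \<in> A" "s \<in> A" "r \<noteq> s"
    let ?h = "\<lambda>C'. g (C', insert (X r) (insert (X s) \<tau>))"
    have "slide s (slide r ?h) C = slide r (slide s ?h) C" by (rule slide_commute[OF rs(3)])
    moreover have "insert (X s) (insert (X r) \<tau>) = insert (X r) (insert (X s) \<tau>)"
      by (rule insert_commute)
    moreover have "(-1) ^ alpha \<tau> s * (-1) ^ alpha (insert (X s) \<tau>) r =
        - ((-1) ^ alpha \<tau> r * (-1) ^ alpha (insert (X r) \<tau>) s :: 'a)"
      using rs assms by (intro alpha_alternate) (auto simp: A_def)
    ultimately show "(-1) ^ alpha \<tau> s * (-1) ^ alpha (insert (X s) \<tau>) r * slide s (slide r ?h) C =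
        - ((-1) ^ alpha \<tau> r * (-1) ^ alpha (insert (X r) \<tau>) s *
          slide r (slide s (\<lambda>C'. g (C', insert (X s) (insert (X r) \<tau>)))) C)"
      by simp
  qed
  finally show ?thesis .
qed

lemma bd_nonzeroE:
  assumes "bd n w (C, \<tau>) \<noteq> 0"
  obtains s where "s \<in> {1..n}" "X s \<notin> \<tau>" "w (C, insert (X s) \<tau>) \<noteq> 0"
  | s where "s \<in> {1..n}" "X s \<notin> \<tau>" "X s \<in> C" "Y s \<notin> C" "w (unswap C s, insert (X s) \<tau>) \<noteq> 0"
proof -
  obtain s where "s \<in> {1..n}" "X s \<notin> \<tau>" "slide s (\<lambda>C'. w (C', insert (X s) \<tau>)) C \<noteq> 0"
    using assms by (fastforce simp: bd_def elim: sum.not_neutral_contains_not_neutral)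
  then show thesis using that by (cases "w (C, insert (X s) \<tau>) = 0") (auto simp: slide_def split: if_splits)
qed

lemma bd_bd:
  assumes "\<And>C \<sigma>. w (C, \<sigma>) \<noteq> 0 \<Longrightarrow> finite \<sigma>"
  shows "bd n (bd n w) b = 0"
proof (cases b)
  case (Pair C \<tau>)
  show ?thesis
  proof (cases "finite \<tau>")
    case True
    then show ?thesis by (simp add: Pair bd_bd_finite)
  next
    \<comment> \<open>Every cell above an infinite \<open>\<tau>\<close> has an infinite second
      component, where the support condition forces the value zero.\<close>
    case False
    have "bd n w (D, \<rho>) = 0" if "infinite \<rho>" for D \<rho>
      using bd_nonzeroE[of n w D \<rho>] assms that by (metis finite_insert)
    then show ?thesis using bd_nonzeroE[of n "bd n w" C \<tau>] False Pair by (metis finite_insert)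
  qed
qed

section \<open>Incidence coefficients of the cells, and exactness with constant coefficients\<close>

definition incidence :: "vertex set \<times> vertex set \<Rightarrow> vertex set \<times> vertex set \<Rightarrow> 'r::comm_ring_1" where
  "incidence = (\<lambda>(C, \<sigma>) b. \<Sum>s | X s \<in> \<sigma>. (-1) ^ alpha \<sigma> s *
     (of_bool (b = (swap C s, \<sigma> - {X s})) - of_bool (b = (C, \<sigma> - {X s}))))"

context unmixed_standard_graph
begin

lemma res_basis_indices:
  assumes "(C, \<sigma>) \<in> res_basis n E i" "X s \<in> \<sigma>"
  shows "s \<in> {1..n}" "Y s \<in> C" "X s \<notin> C"
  using assms covers_X_iff[of C s] by (auto simp: res_basis_iff swappable_def)

text \<open>\<open>incidence\<close> is the matrix of \<open>res_bdry\<close> with all variables set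
  to 1. For fixed \<open>b\<close> and \<open>s\<close>, at most one cell has \<open>b\<close> as
  its swapped face and at most one as its unswapped face, so the product with the matrix collapses
  to the sum in \<open>bd\<close>.\<close>

lemma bd_eq_incidence:
  assumes supp: "\<And>b. g b \<noteq> 0 \<Longrightarrow> b \<in> res_basis n E i"
  shows "(\<Sum>c \<in> res_basis n E i. g c * incidence c b) = bd n g b"
proof (cases b)
  case (Pair D \<tau>)
  let ?B = "res_basis n E i"
  let ?\<tau> = "\<lambda>s. insert (X s) \<tau>"
  \<comment> \<open>Both face relations become equations for \<open>(C, \<sigma>)\<close>, so that
    the sum over cells picks out single terms.\<close>
  have summand: "(if X s \<in> \<sigma> then g (C, \<sigma>) * ((-1) ^ alpha \<sigma> s *
        (of_bool (b = (swap C s, \<sigma> - {X s})) - of_bool (b = (C, \<sigma> - {X s})))) else 0) =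
      (if (C, \<sigma>) = (unswap D s, ?\<tau> s)
        then (if X s \<notin> \<tau> \<and> X s \<in> D \<and> Y s \<notin> D then (-1) ^ alpha \<tau> s * g (C, \<sigma>) else 0) else 0)
      - (if (C, \<sigma>) = (D, ?\<tau> s)
        then (if X s \<notin> \<tau> then (-1) ^ alpha \<tau> s * g (C, \<sigma>) else 0) else 0)"
    if c: "(C, \<sigma>) \<in> ?B" for C \<sigma> s
  proof -
    have fin: "finite \<sigma>" using c by (rule res_basis_finite_snd)
    have 1: "X s \<in> \<sigma> \<and> b = (swap C s, \<sigma> - {X s}) \<longleftrightarrow>
        (C, \<sigma>) = (unswap D s, ?\<tau> s) \<and> X s \<notin> \<tau> \<and> X s \<in> D \<and> Y s \<notin> D"
      using res_basis_indices[OF c, of s] unfolding Pair by (auto simp: swap_def unswap_def)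
    have 2: "X s \<in> \<sigma> \<and> b = (C, \<sigma> - {X s}) \<longleftrightarrow> (C, \<sigma>) = (D, ?\<tau> s) \<and> X s \<notin> \<tau>"
      unfolding Pair by auto
    have 3: "alpha \<sigma> s = alpha \<tau> s" if "\<sigma> = ?\<tau> s" "X s \<notin> \<tau>"
      using fin that by (simp add: alpha_insert)
    show ?thesis using 1 2 3 by (cases "X s \<in> \<sigma>") (auto simp: mult.commute)
  qed
  have supp0: "g c = 0" if "c \<notin> ?B" for c using supp that by blast
  have "(\<Sum>c \<in> ?B. g c * incidence c b) =
      (\<Sum>c \<in> ?B. \<Sum>s \<in> {1..n}. case c of (C, \<sigma>) \<Rightarrow> if X s \<in> \<sigma> then g (C, \<sigma>) *
        ((-1) ^ alpha \<sigma> s *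
        (of_bool (b = (swap C s, \<sigma> - {X s})) - of_bool (b = (C, \<sigma> - {X s})))) else 0)"
  proof (rule sum.cong[OF refl])
    fix c assume "c \<in> ?B"
    then obtain C \<sigma> where c: "c = (C, \<sigma>)" "(C, \<sigma>) \<in> ?B" by (cases c) auto
    have "{s. X s \<in> \<sigma>} = {s \<in> {1..n}. X s \<in> \<sigma>}" using res_basis_indices(1)[OF c(2)] by auto
    then show "g c * incidence c b = (\<Sum>s \<in> {1..n}. case c of (C, \<sigma>) \<Rightarrow> if X s \<in> \<sigma>
        then g (C, \<sigma>) * ((-1) ^ alpha \<sigma> s *
        (of_bool (b = (swap C s, \<sigma> - {X s})) - of_bool (b = (C, \<sigma> - {X s})))) else 0)"
      by (simp only: c incidence_def prod.case sum_distrib_left sum.inter_filter finite_atLeastAtMost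
          if_distrib[of "\<lambda>x. g (C, \<sigma>) * x"] mult_zero_right)
  qed
  also have "\<dots> = (\<Sum>s \<in> {1..n}. \<Sum>c \<in> ?B.
      (if c = (unswap D s, ?\<tau> s)
        then (if X s \<notin> \<tau> \<and> X s \<in> D \<and> Y s \<notin> D then (-1) ^ alpha \<tau> s * g c else 0) else 0)
      - (if c = (D, ?\<tau> s) then (if X s \<notin> \<tau> then (-1) ^ alpha \<tau> s * g c else 0) else 0))"
    by (subst sum.swap) (intro sum.cong refl, clarify, simp only: prod.case summand)
  also have "\<dots> = (\<Sum>s \<in> {1..n}. if X s \<notin> \<tau>
      then (-1) ^ alpha \<tau> s * slide s (\<lambda>C'. g (C', ?\<tau> s)) D else 0)"
    by (intro sum.cong refl)
      (auto simp: sum_subtractf finite_res_basis slide_def supp0 right_diff_distrib)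
  also have "\<dots> = bd n g b"
    by (simp only: Pair bd_def prod.case sum.inter_filter finite_atLeastAtMost)
  finally show ?thesis .
qed

text \<open>A cell of dimension 1 has two end points, both in the basis and with opposite
  signs.\<close>

lemma sum_incidence:
  assumes c: "c \<in> res_basis n E (Suc 0)"
  shows "(\<Sum>b \<in> res_basis n E 0. incidence c b) = (0 :: 'r::comm_ring_1)"
proof (cases c)
  case (Pair C \<sigma>)
  have "(\<Sum>b \<in> res_basis n E 0. of_bool (b = (swap C s, \<sigma> - {X s})) - of_bool (b = (C, \<sigma> - {X s}))) =
      (0 :: 'r)" if "X s \<in> \<sigma>" for s
    using res_basis_face[of C \<sigma> 0 s] c that Pair finite_res_basis
    by (simp add: sum_subtractf of_bool_def)
  then show ?thesis
    unfolding Pair incidence_def prod.case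
    by (subst sum.swap) (simp add: sum_distrib_left[symmetric])
qed

lemma sum_bd:
  assumes supp: "\<And>b. g b \<noteq> 0 \<Longrightarrow> b \<in> res_basis n E (Suc 0)"
  shows "(\<Sum>b \<in> res_basis n E 0. bd n g b) = 0"
proof -
  have "(\<Sum>b \<in> res_basis n E 0. bd n g b) =
      (\<Sum>b \<in> res_basis n E 0. \<Sum>c \<in> res_basis n E (Suc 0). g c * incidence c b)"
    by (simp add: bd_eq_incidence[OF supp])
  also have "\<dots> = (\<Sum>c \<in> res_basis n E (Suc 0). g c * (\<Sum>b \<in> res_basis n E 0. incidence c b))"
    unfolding sum_distrib_left by (rule sum.swap)
  finally show ?thesis by (simp add: sum_incidence)
qed

text \<open>Passing to a face stays inside \<open>D\<close>: the vertex \<open>X s\<close> brought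
  in by a swap already belonged to \<open>\<sigma>\<close>.\<close>

lemma bd_support:
  assumes supp: "\<And>C \<sigma>. w (C, \<sigma>) \<noteq> 0 \<Longrightarrow> (C, \<sigma>) \<in> res_basis n E (Suc i) \<and> C \<union> \<sigma> \<subseteq> D"
    and nz: "bd n w (C, \<tau>) \<noteq> 0"
  shows "(C, \<tau>) \<in> res_basis n E i \<and> C \<union> \<tau> \<subseteq> D"
  using nz
proof (cases rule: bd_nonzeroE)
  case (1 s)
  then show ?thesis
    using supp[of C "insert (X s) \<tau>"] res_basis_face(1)[of C "insert (X s) \<tau>" i s] by simp
next
  case (2 s)
  have "(unswap C s, insert (X s) \<tau>) \<in> res_basis n E (Suc i)" "unswap C s \<union> insert (X s) \<tau> \<subseteq> D"
    using supp[OF 2(5)] by auto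
  then show ?thesis
    using res_basis_face(2)[of "unswap C s" "insert (X s) \<tau>" i s] 2 swap_unswap[of s C]
    by (auto simp: unswap_def)
qed

text \<open>
  Fix \<open>D\<close> and let \<open>C0\<close> be the bottom cover below \<open>D\<close>. Every other cover \<open>C\<close> below \<open>D\<close>
  has a swappable \<open>X t \<in> D\<close>, and \<open>(C, \<sigma>) \<mapsto> (C, \<sigma> \<union> {X t})\<close> contracts the simplex of
  cells over \<open>C\<close>. Removing the covers with the most \<open>Y\<close>'s first leaves only \<open>C0\<close>,
  which carries no cell of positive dimension.
\<close>

lemma bd_exact:
  fixes g :: "vertex set \<times> vertex set \<Rightarrow> 'r::comm_ring_1"
  assumes supp: "\<And>C \<sigma>. g (C, \<sigma>) \<noteq> 0 \<Longrightarrow> (C, \<sigma>) \<in> res_basis n E i \<and> C \<union> \<sigma> \<subseteq> D"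
    and cycle: "\<And>b. bd n g b = 0"
    and aug: "i = 0 \<Longrightarrow> (\<Sum>b \<in> res_basis n E 0. g b) = 0"
  shows "\<exists>w. (\<forall>C \<sigma>. w (C, \<sigma>) \<noteq> 0 \<longrightarrow> (C, \<sigma>) \<in> res_basis n E (Suc i) \<and> C \<union> \<sigma> \<subseteq> D) \<and>
    (\<forall>b. bd n w b = g b)"
proof (cases "\<exists>C \<in> covers. C \<subseteq> D")
  case False
  then have "g (C, \<sigma>) = 0" for C \<sigma> using supp[of C \<sigma>] by (auto simp: res_basis_iff)
  then show ?thesis by (intro exI[of _ "\<lambda>_. 0"]) (auto simp: bd_zero)
next
  case True
  then obtain C1 where C1: "C1 \<in> covers" "C1 \<subseteq> D" by blast
  obtain C0 where C0: "C0 \<in> covers" "C0 \<subseteq> D" "swappable n E C0 \<inter> D = {}"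
    and least: "\<forall>C \<in> covers. C \<subseteq> D \<longrightarrow> y_count C0 \<le> y_count C"
    and ex_t: "\<forall>C \<in> covers. C \<subseteq> D \<and> C \<noteq> C0 \<longrightarrow> (\<exists>t. X t \<in> swappable n E C \<inter> D)"
    by (rule bottom_cover[OF C1])
  \<comment> \<open>The direction depends on the cover alone, so the cells over one cover are paired
    by adding or removing one fixed vertex.\<close>
  define t where "t C = (SOME t. X t \<in> swappable n E C \<inter> D)" for C
  have t: "X (t C) \<in> swappable n E C" "X (t C) \<in> D" if "C \<in> covers" "C \<subseteq> D" "C \<noteq> C0" for C
  proof -
    have "\<exists>t. X t \<in> swappable n E C \<inter> D" using ex_t that by blast
    from someI_ex[OF this] show "X (t C) \<in> swappable n E C" "X (t C) \<in> D" by (auto simp: t_def)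
  qed
  \<comment> \<open>Generalised by a bound \<open>k\<close>: apart from \<open>C0\<close>, the
    support meets only covers with \<open>y_count\<close> below \<open>k\<close>. Each induction
    step clears the layer \<open>y_count C = k\<close>.\<close>
  have "\<exists>w. (\<forall>C \<sigma>. w (C, \<sigma>) \<noteq> 0 \<longrightarrow> (C, \<sigma>) \<in> res_basis n E (Suc i) \<and> C \<union> \<sigma> \<subseteq> D) \<and>
      (\<forall>b. bd n w b = g b)"
    if "\<And>C \<sigma>. g (C, \<sigma>) \<noteq> 0 \<Longrightarrow> (C, \<sigma>) \<in> res_basis n E i \<and> C \<union> \<sigma> \<subseteq> D"
      and "\<And>b. bd n g b = 0"
      and "i = 0 \<Longrightarrow> (\<Sum>b \<in> res_basis n E 0. g b) = 0"
      and "\<And>C \<sigma>. g (C, \<sigma>) \<noteq> 0 \<Longrightarrow> C = C0 \<or> y_count C < k"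
    for g :: "vertex set \<times> vertex set \<Rightarrow> 'r" and k
    using that
  proof (induction k arbitrary: g)
    case 0
    \<comment> \<open>All remaining cells lie over \<open>C0\<close> inside \<open>D\<close>, where
      nothing can be exchanged; a coefficient can survive only at \<open>C0\<close> itself, and the
      augmentation condition removes it.\<close>
    have only: "b = (C0, {}) \<and> i = 0" if "g b \<noteq> 0" for b
    proof (cases b)
      case (Pair C \<sigma>)
      then have *: "(C, \<sigma>) \<in> res_basis n E i" "\<sigma> \<subseteq> D" "C = C0" using 0(1,4)[of C \<sigma>] that by auto
      then have "\<sigma> \<subseteq> swappable n E C0 \<inter> D" by (auto simp: res_basis_iff)
      then have "\<sigma> = {}" using C0(3) by blast
      then show ?thesis using * Pair by (simp add: res_basis_iff)
    qed
    have "g b = 0" for b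
    proof (cases "i = 0")
      case True
      have "(\<Sum>b \<in> res_basis n E 0. g b) = (\<Sum>b \<in> {(C0, {})}. g b)"
      proof (rule sum.mono_neutral_right[OF finite_res_basis])
        show "{(C0, {})} \<subseteq> res_basis n E 0" using C0(1) by (simp add: res_basis_iff)
        show "\<forall>b \<in> res_basis n E 0 - {(C0, {})}. g b = 0" using only by blast
      qed
      then have "g (C0, {}) = 0" using 0(3)[OF True] by simp
      then show ?thesis using only[of b] by (cases "g b = 0") auto
    next
      case False
      then show ?thesis using only by blast
    qed
    then show ?case by (intro exI[of _ "\<lambda>_. 0"]) (auto simp: bd_zero)
  next
    case (Suc k)
    \<comment> \<open>The cone with apex \<open>X (t C)\<close> over each cover of layer
      \<open>k\<close>. The leading minus sign compensates the one in front of \<open>h C\<close> in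
      \<open>slide\<close>, and the sign from \<open>alpha\<close> is its own inverse.\<close>
    define w where "w = (\<lambda>(C, \<sigma>). if C \<noteq> C0 \<and> y_count C = k \<and> X (t C) \<in> \<sigma>
      then - ((-1) ^ alpha \<sigma> (t C) * g (C, \<sigma> - {X (t C)})) else 0)"
    have w_supp: "(C, \<sigma>) \<in> res_basis n E (Suc i) \<and> C \<union> \<sigma> \<subseteq> D" if "w (C, \<sigma>) \<noteq> 0" for C \<sigma>
    proof -
      have *: "C \<noteq> C0" "X (t C) \<in> \<sigma>" "g (C, \<sigma> - {X (t C)}) \<noteq> 0"
        using that by (auto simp: w_def split: if_splits)
      have **: "(C, \<sigma> - {X (t C)}) \<in> res_basis n E i" "C \<union> (\<sigma> - {X (t C)}) \<subseteq> D"
        using Suc.prems(1)[OF *(3)] by auto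
      then have "X (t C) \<in> swappable n E C" "X (t C) \<in> D"
        using t[of C] *(1) by (auto simp: res_basis_iff)
      moreover have "finite \<sigma>" using res_basis_finite_snd[OF **(1)] by simp
      then have "card \<sigma> = Suc i"
        using card.remove[of \<sigma> "X (t C)"] *(2) **(1) by (simp add: res_basis_iff)
      ultimately show ?thesis using * ** by (auto simp: res_basis_iff)
    qed
    have bw_supp: "(C, \<tau>) \<in> res_basis n E i \<and> C \<union> \<tau> \<subseteq> D" if "bd n w (C, \<tau>) \<noteq> 0" for C \<tau>
      using bd_support[OF w_supp that] by blast
    define g' where "g' = (\<lambda>b. g b - bd n w b)"
    have g'_supp: "(C, \<tau>) \<in> res_basis n E i \<and> C \<union> \<tau> \<subseteq> D" if "g' (C, \<tau>) \<noteq> 0" for C \<tau>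
      using that Suc.prems(1)[of C \<tau>] bw_supp[of C \<tau>]
      by (cases "g (C, \<tau>) = 0") (auto simp: g'_def)
    have g'_cycle: "bd n g' b = 0" for b
    proof -
      have "finite \<sigma>" if "w (C, \<sigma>) \<noteq> 0" for C \<sigma>
        using w_supp[OF that] res_basis_finite_snd by blast
      then have "bd n (bd n w) b = 0" by (rule bd_bd)
      then show ?thesis unfolding g'_def bd_diff using Suc.prems(2)[of b] by simp
    qed
    have g'_aug: "(\<Sum>b \<in> res_basis n E 0. g' b) = 0" if "i = 0"
    proof -
      have "b \<in> res_basis n E (Suc 0)" if "w b \<noteq> 0" for b
        using w_supp[of "fst b" "snd b"] that \<open>i = 0\<close> by simp
      then show ?thesis using Suc.prems(3)[OF that] by (simp add: g'_def sum_subtractf sum_bd)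
    qed
    \<comment> \<open>The correction \<open>bd n w\<close> agrees with \<open>g\<close> on layer
      \<open>k\<close>, and both vanish above it away from \<open>C0\<close>.\<close>
    have g'_below: "C = C0 \<or> y_count C < k" if nz: "g' (C, \<tau>) \<noteq> 0" for C \<tau>
    proof (rule ccontr)
      assume "\<not> (C = C0 \<or> y_count C < k)"
      then have C: "C \<noteq> C0" "y_count C \<ge> k" by auto
      have cell: "C \<in> covers" "C \<subseteq> D" "finite \<tau>"
        using g'_supp[OF nz] res_basis_finite_snd by (auto simp: res_basis_iff)
      \<comment> \<open>Undoing a swap raises \<open>y_count\<close> past \<open>k\<close>, and
        \<open>C0\<close> has the least \<open>y_count\<close>; so only the terms of
        \<open>slide\<close> that keep \<open>C\<close> contribute.\<close>
      have up: "unswap C s \<noteq> C0 \<and> k < y_count (unswap C s)" if "Y s \<notin> C" for s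
        using y_count_unswap[OF covers_subset[OF cell(1)] that] bspec[OF least cell(1)] cell(2) C(2) by auto
      have w_up: "w (unswap C s, \<rho>) = 0" if "Y s \<notin> C" for s \<rho>
        using up[OF that] by (simp add: w_def)
      have bw: "bd n w (C, \<tau>) = - (\<Sum>s | s \<in> {1..n} \<and> X s \<notin> \<tau>.
          (-1) ^ alpha \<tau> s * w (C, insert (X s) \<tau>))"
        by (simp add: bd_def slide_def w_up sum_negf cong: if_cong conj_cong)
      show False
      proof (cases "y_count C = k")
        case False
        then have "bd n w (C, \<tau>) = 0" unfolding bw by (simp add: w_def)
        moreover have "g (C, \<tau>) = 0" using Suc.prems(4)[of C \<tau>] C False by force
        ultimately show False using nz by (simp add: g'_def)
      next
        case True
        note top = this
        let ?t = "t C"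
        have tn: "?t \<in> {1..n}" using t(1)[OF cell(1,2) C(1)] by (simp add: swappable_iff)
        have g_up: "g (unswap C s, \<rho>) = 0" if "Y s \<notin> C" for s \<rho>
          using up[OF that] Suc.prems(4)[of "unswap C s" \<rho>] by force
        have "bd n w (C, \<tau>) = g (C, \<tau>)"
        proof (cases "X ?t \<in> \<tau>")
          case False
          \<comment> \<open>A nonzero value of \<open>w\<close> needs \<open>X (t C)\<close> in the
            second component, so only the direction \<open>t C\<close> is left.\<close>
          have "(\<Sum>s | s \<in> {1..n} \<and> X s \<notin> \<tau>. (-1) ^ alpha \<tau> s * w (C, insert (X s) \<tau>)) =
              (\<Sum>s \<in> {?t}. (-1) ^ alpha \<tau> s * w (C, insert (X s) \<tau>))"
            using False tn by (intro sum.mono_neutral_right) (auto simp: w_def)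
          also have "\<dots> = - g (C, \<tau>)"
            using False C top cell(3) by (simp add: w_def alpha_insert)
          finally show ?thesis unfolding bw by simp
        next
          case True
          \<comment> \<open>The cycle condition at the smaller cell \<open>(C, \<rho>)\<close>
            expresses \<open>g (C, \<tau>)\<close> through the other cells over \<open>C\<close>
            that have \<open>(C, \<rho>)\<close> as a face.\<close>
          define \<rho> where "\<rho> = \<tau> - {X ?t}"
          have \<rho>: "finite \<rho>" "X ?t \<notin> \<rho>" "\<tau> = insert (X ?t) \<rho>" using True cell(3) by (auto simp: \<rho>_def)
          let ?A = "{s. s \<in> {1..n} \<and> X s \<notin> \<tau>}"
          have A: "{s. s \<in> {1..n} \<and> X s \<notin> \<rho>} = insert ?t ?A" using \<rho> tn by auto
          have "0 = bd n g (C, \<rho>)" using Suc.prems(2) by simp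
          also have "\<dots> = - (\<Sum>s \<in> insert ?t ?A. (-1) ^ alpha \<rho> s * g (C, insert (X s) \<rho>))"
            unfolding A[symmetric] by (simp add: bd_def slide_def g_up sum_negf cong: if_cong conj_cong)
          also have "\<dots> = - ((-1) ^ alpha \<rho> ?t * g (C, \<tau>)) -
              (\<Sum>s \<in> ?A. (-1) ^ alpha \<rho> s * g (C, insert (X s) \<rho>))"
            using \<rho>(3) by (subst sum.insert) auto
          finally have eq: "(-1) ^ alpha \<rho> ?t * g (C, \<tau>) =
              - (\<Sum>s \<in> ?A. (-1) ^ alpha \<rho> s * g (C, insert (X s) \<rho>))"
            by (simp add: algebra_simps eq_neg_iff_add_eq_0)
          have "g (C, \<tau>) = (-1) ^ alpha \<rho> ?t * ((-1) ^ alpha \<rho> ?t * g (C, \<tau>))"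
            by (simp add: mult.assoc[symmetric])
          also have "\<dots> = - (\<Sum>s \<in> ?A. (-1) ^ alpha \<rho> ?t *
              ((-1) ^ alpha \<rho> s * g (C, insert (X s) \<rho>)))"
            unfolding eq by (simp add: sum_distrib_left)
          also have "\<dots> = - (\<Sum>s \<in> ?A. (-1) ^ alpha \<tau> s * w (C, insert (X s) \<tau>))"
          proof -
            \<comment> \<open>Exchanging the order in which \<open>X s\<close> and
              \<open>X (t C)\<close> are added gives a minus sign that cancels the one in
              \<open>w\<close>.\<close>
            have "(-1) ^ alpha \<rho> ?t * ((-1) ^ alpha \<rho> s * g (C, insert (X s) \<rho>)) =
                (-1) ^ alpha \<tau> s * w (C, insert (X s) \<tau>)" if "s \<in> ?A" for s
            proof -
              have s: "X s \<notin> \<rho>" "s \<noteq> ?t" using that \<rho> by auto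
              have "w (C, insert (X s) \<tau>) =
                  - ((-1) ^ alpha (insert (X s) \<tau>) ?t * g (C, insert (X s) \<rho>))"
              proof -
                have "insert (X s) \<tau> - {X ?t} = insert (X s) \<rho>" using s \<rho> by auto
                then show ?thesis using C top True by (simp add: w_def)
              qed
              moreover have "alpha (insert (X s) \<tau>) ?t = alpha (insert (X s) \<rho>) ?t"
                using \<rho> s alpha_insert[of "insert (X s) \<rho>" ?t ?t] by (simp add: insert_commute)
              moreover have "(-1) ^ alpha \<rho> ?t * (-1) ^ alpha \<tau> s =
                  - ((-1) ^ alpha \<rho> s * (-1) ^ alpha (insert (X s) \<rho>) ?t :: 'r)"
                unfolding \<rho>(3) using \<rho>(1,2) s by (intro alpha_alternate) auto
              ultimately show ?thesis
                using \<rho> s by (simp add: alpha_insert)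
            qed
            then show ?thesis by simp
          qed
          finally show ?thesis unfolding bw by simp
        qed
        then show False using nz by (simp add: g'_def)
      qed
    qed
    have "\<exists>w. (\<forall>C \<sigma>. w (C, \<sigma>) \<noteq> 0 \<longrightarrow> (C, \<sigma>) \<in> res_basis n E (Suc i) \<and> C \<union> \<sigma> \<subseteq> D) \<and>
        (\<forall>b. bd n w b = g' b)"
      by (rule Suc.IH) (fact g'_supp g'_cycle g'_aug g'_below)+
    then obtain w' where w': "\<forall>C \<sigma>. w' (C, \<sigma>) \<noteq> 0 \<longrightarrow> (C, \<sigma>) \<in> res_basis n E (Suc i) \<and> C \<union> \<sigma> \<subseteq> D"
        "\<forall>b. bd n w' b = g' b"
      by blast
    \<comment> \<open>The double negation writes the sum of \<open>w\<close> and \<open>w'\<close>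
      as a difference, the form covered by \<open>bd_diff\<close>.\<close>
    have "bd n (\<lambda>b. w b - - w' b) b = g b" for b
    proof -
      have "bd n (\<lambda>b. - w' b) b = - g' b"
        using bd_diff[of n "\<lambda>_. 0" w' b] by (simp add: bd_zero w'(2))
      then show ?thesis unfolding bd_diff by (simp add: g'_def)
    qed
    moreover have "(C, \<sigma>) \<in> res_basis n E (Suc i) \<and> C \<union> \<sigma> \<subseteq> D" if "w (C, \<sigma>) - - w' (C, \<sigma>) \<noteq> 0" for C \<sigma>
      using that w_supp[of C \<sigma>] w'(1) by (cases "w (C, \<sigma>) = 0") auto
    ultimately show ?case by (intro exI[of _ "\<lambda>b. w b - - w' b"]) blast
  qed
  note reduce = this
  \<comment> \<open>A cover has at most \<open>n\<close> vertices \<open>Y j\<close>, so the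
    induction can start at \<open>Suc n\<close>.\<close>
  have "y_count C < Suc n" if "g (C, \<sigma>) \<noteq> 0" for C \<sigma>
  proof -
    have "C \<subseteq> vertices n" using supp[OF that] covers_subset by (auto simp: res_basis_iff)
    then have "{j. Y j \<in> C} \<subseteq> {1..n}" by (auto dest: subsetD)
    then have "card {j. Y j \<in> C} \<le> card {1..n}" by (intro card_mono) simp_all
    then show ?thesis by (simp add: y_count_def)
  qed
  then show ?thesis using reduce[of g "Suc n"] supp cycle aug by blast
qed

end

section \<open>Polynomial rings and monomials\<close>

lemma poly_ring_simps [simp]:
  "mult (poly_ring V) = (*)" "one (poly_ring V) = 1"
  "zero (poly_ring V) = 0" "add (poly_ring V) = (+)"
  by (simp_all add: poly_ring_def)

lemma carrier_poly_ring:
  "p \<in> carrier (poly_ring V) \<longleftrightarrow> (\<forall>m \<in> Poly_Mapping.keys p. Poly_Mapping.keys m \<subseteq> V)"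
  by (simp add: poly_ring_def)

lemma keys_monomial_add:
  "Poly_Mapping.keys (s + t :: 'v monomial) = Poly_Mapping.keys s \<union> Poly_Mapping.keys t"
  by (auto simp: in_keys_iff lookup_add)

lemma poly_ring_closed:
  assumes "p \<in> carrier (poly_ring V)" "q \<in> carrier (poly_ring V)"
  shows "p + q \<in> carrier (poly_ring V)" "p * q \<in> carrier (poly_ring V)"
    "- p \<in> carrier (poly_ring V)"
proof -
  show "p + q \<in> carrier (poly_ring V)"
    using assms keys_add[of p q] unfolding carrier_poly_ring by blast
  show "p * q \<in> carrier (poly_ring V)"
    unfolding carrier_poly_ring
  proof
    fix m assume "m \<in> Poly_Mapping.keys (p * q)"
    then obtain s t where "m = s + t" "s \<in> Poly_Mapping.keys p" "t \<in> Poly_Mapping.keys q"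
      using keys_mult[of p q] by blast
    then show "Poly_Mapping.keys m \<subseteq> V"
      using assms unfolding carrier_poly_ring by (simp add: keys_monomial_add)
  qed
  show "- p \<in> carrier (poly_ring V)"
    using assms(1) unfolding carrier_poly_ring by (simp add: in_keys_iff)
qed

lemma poly_ring_0_1 [simp]: "0 \<in> carrier (poly_ring V)" "1 \<in> carrier (poly_ring V)"
  by (simp_all add: carrier_poly_ring)

lemma poly_ring_diff_closed:
  "p \<in> carrier (poly_ring V) \<Longrightarrow> q \<in> carrier (poly_ring V) \<Longrightarrow> p - q \<in> carrier (poly_ring V)"
  using poly_ring_closed(1)[of p V "- q"] poly_ring_closed(3)[of q V q] by simp

lemma poly_ring_sum_closed:
  "(\<And>a. a \<in> A \<Longrightarrow> f a \<in> carrier (poly_ring V)) \<Longrightarrow> sum f A \<in> carrier (poly_ring V)"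
  by (induction A rule: infinite_finite_induct) (auto intro: poly_ring_closed(1))

lemma poly_ring_power_closed:
  "p \<in> carrier (poly_ring V) \<Longrightarrow> p ^ k \<in> carrier (poly_ring V)"
  by (induction k) (auto intro: poly_ring_closed(2))

lemma poly_ring_sign_closed: "(-1) ^ k \<in> carrier (poly_ring V)"
  using poly_ring_power_closed[OF poly_ring_closed(3)[of 1 V 1]] by simp

lemma pvar_closed: "z \<in> V \<Longrightarrow> pvar z \<in> carrier (poly_ring V)"
  by (simp add: carrier_poly_ring pvar_def)

lemma pprod_closed: "C \<subseteq> V \<Longrightarrow> pprod C \<in> carrier (poly_ring V)"
  unfolding pprod_def
  by (induction C rule: infinite_finite_induct) (auto intro: poly_ring_closed(2) pvar_closed)

lemma cring_poly_ring: "cring (poly_ring V :: ('v, 'k::field) mpoly ring)" (is "cring ?S")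
proof (rule cringI)
  show "abelian_group ?S"
  proof (rule abelian_groupI)
    show "\<exists>y \<in> carrier ?S. y \<oplus>\<^bsub>?S\<^esub> p = \<zero>\<^bsub>?S\<^esub>" if "p \<in> carrier ?S" for p
      using poly_ring_closed(3)[OF that that] by (intro bexI[of _ "- p"]) auto
  qed (auto simp: add_ac intro: poly_ring_closed)
  show "comm_monoid ?S"
    by (rule comm_monoidI) (auto simp: mult_ac intro: poly_ring_closed)
qed (auto simp: distrib_right)

lemma a_inv_poly_ring:
  assumes "p \<in> carrier (poly_ring V)"
  shows "\<ominus>\<^bsub>poly_ring V\<^esub> p = - p"
proof -
  interpret cring "poly_ring V" by (rule cring_poly_ring)
  show ?thesis
    using assms poly_ring_closed(3)[OF assms assms] by (intro minus_equality) auto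
qed

lemma ideal_sum:
  assumes "ideal I (poly_ring V)" and "\<And>a. a \<in> A \<Longrightarrow> f a \<in> I"
  shows "sum f A \<in> I"
proof -
  interpret additive_subgroup I "poly_ring V" using assms(1) by (rule ideal.axioms)
  have "0 \<in> I" "\<And>x y. x \<in> I \<Longrightarrow> y \<in> I \<Longrightarrow> x + y \<in> I"
    using additive_subgroup.zero_closed[OF additive_subgroup_axioms]
      additive_subgroup.a_closed[OF additive_subgroup_axioms] by simp_all
  then show ?thesis
    using assms(2) by (induction A rule: infinite_finite_induct) auto
qed

section \<open>Multiplication by monomials, and coefficients in a fixed multidegree\<close>

lemma lookup_monomial_mult:
  fixes p :: "('v, 'k::field) mpoly"
  shows "Poly_Mapping.lookup (Poly_Mapping.single u 1 * p) (u + t) = Poly_Mapping.lookup p t"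
proof -
  have "Poly_Mapping.lookup (Poly_Mapping.single u 1 * p) (u + t) =
      (\<Sum>l. (\<Sum>q. Poly_Mapping.lookup p q when u + t = l + q) when u = l)"
    by (simp add: lookup_mult lookup_single when_mult)
  then show ?thesis by simp
qed

lemma keys_monomial_mult:
  fixes p :: "('v, 'k::field) mpoly"
  assumes "Poly_Mapping.lookup (Poly_Mapping.single u 1 * p) m \<noteq> 0"
  obtains t where "m = u + t" "Poly_Mapping.lookup p t \<noteq> 0"
proof -
  have "m \<in> Poly_Mapping.keys (Poly_Mapping.single u 1 * p)" using assms by (simp add: in_keys_iff)
  then obtain t where "m = u + t" "t \<in> Poly_Mapping.keys p"
    using keys_mult[of "Poly_Mapping.single u 1" p] by auto
  then show thesis using that by (simp add: in_keys_iff)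
qed

lemma monomial_mult_cancel:
  fixes p q :: "('v, 'k::field) mpoly"
  assumes "Poly_Mapping.single u 1 * p = Poly_Mapping.single u 1 * q"
  shows "p = q"
  by (rule poly_mapping_eqI) (metis assms lookup_monomial_mult)

lemma pprod_monomial: "finite C \<Longrightarrow> pprod C = Poly_Mapping.single (mdeg_prod C) 1"
proof (induction C rule: finite_induct)
  case empty
  then show ?case by (simp add: pprod_def mdeg_prod_def)
next
  case (insert z C)
  then show ?case by (simp add: pprod_def mdeg_prod_def pvar_def mult_single)
qed

lemma lookup_mdeg_prod:
  "finite C \<Longrightarrow> Poly_Mapping.lookup (mdeg_prod C) z = of_bool (z \<in> C)"
  by (simp add: mdeg_prod_def lookup_sum lookup_single when_def of_bool_def)

lemma mdeg_prod_insert: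
  "finite C \<Longrightarrow> z \<notin> C \<Longrightarrow> mdeg_prod (insert z C) = Poly_Mapping.single z 1 + mdeg_prod C"
  by (simp add: mdeg_prod_def)

lemma mdeg_prod_Un_disjoint:
  "finite C \<Longrightarrow> finite D \<Longrightarrow> C \<inter> D = {} \<Longrightarrow> mdeg_prod (C \<union> D) = mdeg_prod C + mdeg_prod D"
  by (simp add: mdeg_prod_def sum.union_disjoint)

text \<open>Subtraction of exponents is truncated; the inclusion says that the squarefree monomial
  of \<open>C\<close> divides the monomial \<open>m\<close>.\<close>

lemma mdeg_prod_add_diff:
  assumes "finite C" "C \<subseteq> Poly_Mapping.keys m"
  shows "mdeg_prod C + (m - mdeg_prod C) = m"
proof (rule poly_mapping_eqI)
  fix z
  show "Poly_Mapping.lookup (mdeg_prod C + (m - mdeg_prod C)) z = Poly_Mapping.lookup m z"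
    using assms by (cases "z \<in> C") (auto simp: lookup_add lookup_minus lookup_mdeg_prod in_keys_iff)
qed

lemma keys_mdeg_prod: "finite C \<Longrightarrow> Poly_Mapping.keys (mdeg_prod C) = C"
  by (auto simp: in_keys_iff lookup_mdeg_prod)

lemma lookup_sign_mult:
  fixes p :: "('v, 'k::field) mpoly"
  shows "Poly_Mapping.lookup ((-1) ^ k * p) m = (-1) ^ k * Poly_Mapping.lookup p m"
  by (cases "even k") simp_all

lemma lookup_slide:
  fixes h :: "vertex set \<Rightarrow> ('v, 'k::field) mpoly"
  shows
  "Poly_Mapping.lookup (slide s h C) m = slide s (\<lambda>C'. Poly_Mapping.lookup (h C') m) C"
  by (simp add: slide_def lookup_minus)

text \<open>\<open>bd\<close> has constant coefficients, so it commutes with taking the coefficient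
  of a monomial. This is the reduction to one multidegree.\<close>

lemma lookup_bd:
  fixes u :: "vertex set \<times> vertex set \<Rightarrow> ('v, 'k::field) mpoly"
  shows "Poly_Mapping.lookup (bd n u b) m = bd n (\<lambda>c. Poly_Mapping.lookup (u c) m) b"
  by (cases b) (simp add: bd_def lookup_sum lookup_sign_mult lookup_slide)

section \<open>Free modules over the polynomial ring\<close>

lemma carrier_free_module:
  assumes "finite B"
  shows "v \<in> carrier (free_module (poly_ring V) B) \<longleftrightarrow>
    (\<forall>b. v b \<in> carrier (poly_ring V)) \<and> (\<forall>b. b \<notin> B \<longrightarrow> v b = 0)"
proof
  assume "(\<forall>b. v b \<in> carrier (poly_ring V)) \<and> (\<forall>b. b \<notin> B \<longrightarrow> v b = 0)"
  moreover from this have "finite {b. v b \<noteq> 0}" by (intro finite_subset[OF _ assms]) auto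
  ultimately show "v \<in> carrier (free_module (poly_ring V) B)" by (simp add: free_module_def)
next
  assume "v \<in> carrier (free_module (poly_ring V) B)"
  then have v: "\<forall>b \<in> B. v b \<in> carrier (poly_ring V)" "\<forall>b. b \<notin> B \<longrightarrow> v b = 0"
    by (auto simp: free_module_def)
  then show "(\<forall>b. v b \<in> carrier (poly_ring V)) \<and> (\<forall>b. b \<notin> B \<longrightarrow> v b = 0)"
    by (metis poly_ring_0_1(1))
qed

lemma free_module_simps [simp]:
  "add (free_module (poly_ring V) B) = (\<lambda>u v b. u b + v b)"
  "zero (free_module (poly_ring V) B) = (\<lambda>_. 0)"
  "smult (free_module (poly_ring V) B) = (\<lambda>r v b. r * v b)"
  by (simp_all add: free_module_def)

lemma ideal_module_simps [simp]:
  "carrier (ideal_module (poly_ring V) J) = J"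
  "add (ideal_module (poly_ring V) J) = (+)"
  "smult (ideal_module (poly_ring V) J) = (*)"
  by (simp_all add: ideal_module_def)

section \<open>The complex\<close>

text \<open>
  Multiplying every coordinate by the monomial of its multidegree makes the boundary map
  one with coefficients \<open>0\<close>, \<open>1\<close> and \<open>-1\<close>, so that it acts on each multidegree separately.
\<close>

definition homog ::
  "(vertex set \<times> vertex set \<Rightarrow> (vertex, 'k::field) mpoly) \<Rightarrow>
   vertex set \<times> vertex set \<Rightarrow> (vertex, 'k) mpoly" where
  "homog v b = Poly_Mapping.single (res_mdeg 0 b) 1 * v b"

lemma res_mdeg_0: "res_mdeg i = res_mdeg 0"
  by (simp add: res_mdeg_def)

lemma homog_cancel: "homog u b = homog v b \<Longrightarrow> u b = v b"
  unfolding homog_def by (rule monomial_mult_cancel)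

lemma homog_nonzero: "homog v b \<noteq> 0 \<Longrightarrow> v b \<noteq> 0"
  by (auto simp: homog_def)

text \<open>After \<open>homog\<close>, every term of a coordinate is indexed by its true
  multidegree in the free module.\<close>

lemma hom_vec_iff:
  "hom_vec (res_mdeg i) m v \<longleftrightarrow> (\<forall>b m'. Poly_Mapping.lookup (homog v b) m' \<noteq> 0 \<longrightarrow> m' = m)"
proof
  assume hom: "hom_vec (res_mdeg i) m v"
  show "\<forall>b m'. Poly_Mapping.lookup (homog v b) m' \<noteq> 0 \<longrightarrow> m' = m"
  proof (intro allI impI)
    fix b m' assume "Poly_Mapping.lookup (homog v b) m' \<noteq> 0"
    then obtain t where "m' = res_mdeg 0 b + t" "Poly_Mapping.lookup (v b) t \<noteq> 0"
      unfolding homog_def by (rule keys_monomial_mult)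
    then show "m' = m"
      using hom unfolding hom_vec_def res_mdeg_0[of i] by (metis add.commute in_keys_iff)
  qed
next
  assume hom: "\<forall>b m'. Poly_Mapping.lookup (homog v b) m' \<noteq> 0 \<longrightarrow> m' = m"
  have "t + res_mdeg 0 b = m" if "t \<in> Poly_Mapping.keys (v b)" for b t
  proof -
    have "Poly_Mapping.lookup (homog v b) (res_mdeg 0 b + t) \<noteq> 0"
      using that by (simp add: homog_def lookup_monomial_mult in_keys_iff)
    then show ?thesis using hom by (metis add.commute)
  qed
  then show "hom_vec (res_mdeg i) m v" unfolding hom_vec_def res_mdeg_0[of i] by blast
qed

context unmixed_standard_graph
begin

lemma res_basis_finite: "(C, \<sigma>) \<in> res_basis n E i \<Longrightarrow> finite C \<and> finite \<sigma>"
  using res_basis_finite_snd finite_subset[OF covers_subset] by (auto simp: res_basis_iff)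

text \<open>\<open>C\<close> and \<open>\<sigma>\<close> are disjoint, so the multidegree is
  squarefree and its dividing \<open>m\<close> amounts to the inclusion of
  \<open>C \<union> \<sigma>\<close> in the support of \<open>m\<close>.\<close>

lemma res_basis_mdeg:
  assumes "(C, \<sigma>) \<in> res_basis n E i"
  shows "res_mdeg 0 (C, \<sigma>) = mdeg_prod (C \<union> \<sigma>)"
proof -
  have "C \<inter> \<sigma> = {}" using assms swappable_disjoint by (auto simp: res_basis_iff)
  then show ?thesis
    using res_basis_finite[OF assms] by (simp add: res_mdeg_def mdeg_prod_Un_disjoint)
qed

text \<open>The variable in front of a face makes up exactly for the difference between its
  multidegree and that of \<open>c\<close>.\<close>

lemma res_bdry_incidence:
  assumes c: "c \<in> res_basis n E i"
  shows "Poly_Mapping.single (res_mdeg 0 b) 1 * res_bdry c b =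
    (Poly_Mapping.single (res_mdeg 0 c) 1 * incidence c b :: (vertex, 'k::field) mpoly)"
proof (cases c)
  case (Pair C \<sigma>)
  have fin: "finite C" "finite \<sigma>" using res_basis_finite c Pair by auto
  have "Poly_Mapping.single (res_mdeg 0 b) 1 * (pvar (Y s) * unit_vec (swap C s, \<sigma> - {X s}) b
      - pvar (X s) * unit_vec (C, \<sigma> - {X s}) b) =
    (Poly_Mapping.single (res_mdeg 0 c) 1 * (of_bool (b = (swap C s, \<sigma> - {X s}))
      - of_bool (b = (C, \<sigma> - {X s}))) :: (vertex, 'k) mpoly)"
    if s: "X s \<in> \<sigma>" for s
  proof -
    have mem: "Y s \<in> C" "X s \<notin> C" using res_basis_indices c Pair s by auto
    have \<sigma>: "mdeg_prod \<sigma> = Poly_Mapping.single (X s) 1 + mdeg_prod (\<sigma> - {X s})"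
      using mdeg_prod_insert[of "\<sigma> - {X s}" "X s"] fin s by (simp add: insert_absorb)
    have C: "mdeg_prod C = Poly_Mapping.single (Y s) 1 + mdeg_prod (C - {Y s})"
      using mdeg_prod_insert[of "C - {Y s}" "Y s"] fin mem by (simp add: insert_absorb)
    have sw: "mdeg_prod (swap C s) = Poly_Mapping.single (X s) 1 + mdeg_prod (C - {Y s})"
      using mdeg_prod_insert[of "C - {Y s}" "X s"] fin mem by (simp add: swap_def)
    have 1: "res_mdeg 0 (swap C s, \<sigma> - {X s}) + Poly_Mapping.single (Y s) 1 = res_mdeg 0 c"
      unfolding Pair by (simp add: res_mdeg_def \<sigma> C sw add_ac)
    have 2: "res_mdeg 0 (C, \<sigma> - {X s}) + Poly_Mapping.single (X s) 1 = res_mdeg 0 c"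
      unfolding Pair by (simp add: res_mdeg_def \<sigma> add_ac)
    have 3: "Poly_Mapping.single (res_mdeg 0 b) 1 * (pvar (Y s) * unit_vec (swap C s, \<sigma> - {X s}) b) =
        (Poly_Mapping.single (res_mdeg 0 c) 1 * of_bool (b = (swap C s, \<sigma> - {X s})) :: (vertex, 'k) mpoly)"
      by (auto simp: unit_vec_def pvar_def mult_single 1 simp del: One_nat_def)
    have 4: "Poly_Mapping.single (res_mdeg 0 b) 1 * (pvar (X s) * unit_vec (C, \<sigma> - {X s}) b) =
        (Poly_Mapping.single (res_mdeg 0 c) 1 * of_bool (b = (C, \<sigma> - {X s})) :: (vertex, 'k) mpoly)"
      by (auto simp: unit_vec_def pvar_def mult_single 2 simp del: One_nat_def)
    show ?thesis unfolding right_diff_distrib 3 4 ..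
  qed
  note summand = this
  show ?thesis
    unfolding Pair res_bdry_def incidence_def prod.case sum_distrib_left
    using summand unfolding Pair
    by (intro sum.cong refl) (simp only: mem_Collect_eq
        mult.left_commute[of "Poly_Mapping.single _ _" "(-1) ^ alpha \<sigma> _"])
qed

text \<open>\<open>homog\<close> turns the differential into \<open>bd\<close>. The support
  condition reconciles \<open>bd\<close>, which sees all pairs, with \<open>res_diff\<close>, which
  sums over the basis.\<close>

lemma homog_res_diff:
  assumes "\<And>b. b \<notin> res_basis n E i \<Longrightarrow> v b = 0"
  shows "homog (res_diff n E i v) b = bd n (homog v) b"
proof -
  have supp: "c \<in> res_basis n E i" if "homog v c \<noteq> 0" for c
    using assms[of c] homog_nonzero[OF that] by blast
  have "homog (res_diff n E i v) b =
      (\<Sum>c \<in> res_basis n E i. v c * (Poly_Mapping.single (res_mdeg 0 b) 1 * res_bdry c b))"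
    by (simp add: homog_def res_diff_def sum_distrib_left mult.left_commute)
  also have "\<dots> = (\<Sum>c \<in> res_basis n E i. homog v c * incidence c b)"
    by (intro sum.cong refl) (subst res_bdry_incidence, assumption, simp add: homog_def mult_ac)
  also have "\<dots> = bd n (homog v) b" using supp by (rule bd_eq_incidence)
  finally show ?thesis .
qed

text \<open>In degree 0 the second component is empty, so the multidegree of a cell is that of
  \<open>pprod C\<close> and the augmentation becomes the plain sum of coordinates.\<close>

lemma res_aug_homog: "res_aug n E v = (\<Sum>b \<in> res_basis n E 0. homog v b)"
proof -
  have "v b * pprod (fst b) = homog v b" if "b \<in> res_basis n E 0" for b
  proof (cases b)
    case (Pair C \<sigma>)
    then have b: "(C, \<sigma>) \<in> res_basis n E 0" using that by simp
    then have "card \<sigma> = 0" by (simp add: res_basis_iff)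
    then have "finite C" "\<sigma> = {}" using res_basis_finite[OF b] by simp_all
    then show ?thesis
      by (simp add: Pair homog_def res_mdeg_def pprod_monomial mdeg_prod_def mult.commute)
  qed
  then show ?thesis by (simp add: res_aug_def)
qed

section \<open>Exactness of the complex, one multidegree at a time\<close>

abbreviation res_module ::
  "nat \<Rightarrow> ((vertex, 'k::field) mpoly, vertex set \<times> vertex set \<Rightarrow> (vertex, 'k) mpoly) module" where
  "res_module i \<equiv> free_module (poly_ring (vertices n)) (res_basis n E i)"

lemma res_module_closed: "v \<in> carrier (res_module i) \<Longrightarrow> v b \<in> carrier (poly_ring (vertices n))"
  and res_module_support: "v \<in> carrier (res_module i) \<Longrightarrow> b \<notin> res_basis n E i \<Longrightarrow> v b = 0"
  using carrier_free_module[OF finite_res_basis] by blast+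

lemma res_moduleI:
  assumes "\<And>b. v b \<in> carrier (poly_ring (vertices n))"
    and "\<And>b. b \<notin> res_basis n E i \<Longrightarrow> v b = 0"
  shows "v \<in> carrier (res_module i)"
  using carrier_free_module[OF finite_res_basis] assms by blast

text \<open>The coefficients of \<open>homog v\<close> at a monomial \<open>m\<close> form a cycle
  on the cells inside the support of \<open>m\<close>, so \<open>bd_exact\<close> gives a preimage
  for each \<open>m\<close>; these are divided by the multidegrees of the cells and summed.\<close>

lemma res_exact:
  fixes v :: "vertex set \<times> vertex set \<Rightarrow> (vertex, 'k::field) mpoly"
  assumes v: "v \<in> carrier (res_module i)"
    and cycle: "\<And>b. bd n (homog v) b = 0"
    and aug: "i = 0 \<Longrightarrow> res_aug n E v = 0"
  shows "v \<in> res_diff n E (Suc i) ` carrier (res_module (Suc i))"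
proof -
  let ?S = "poly_ring (vertices n) :: (vertex, 'k) mpoly ring"
  define g where "g m b = Poly_Mapping.lookup (homog v b) m" for m b
  have v0: "v b = 0" if "b \<notin> res_basis n E i" for b
    using v that by (rule res_module_support)
  have g_cell: "(C, \<sigma>) \<in> res_basis n E i \<and> C \<union> \<sigma> \<subseteq> Poly_Mapping.keys m \<and>
      Poly_Mapping.keys m \<subseteq> vertices n" if nz: "g m (C, \<sigma>) \<noteq> 0" for m C \<sigma>
  proof -
    obtain t where t: "m = res_mdeg 0 (C, \<sigma>) + t" "Poly_Mapping.lookup (v (C, \<sigma>)) t \<noteq> 0"
      using nz unfolding g_def homog_def by (rule keys_monomial_mult)
    then have b: "(C, \<sigma>) \<in> res_basis n E i" using v0[of "(C, \<sigma>)"] by fastforce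
    have "Poly_Mapping.keys m = C \<union> \<sigma> \<union> Poly_Mapping.keys t"
      using t(1) res_basis_finite[OF b] by (simp add: res_basis_mdeg[OF b] keys_monomial_add keys_mdeg_prod)
    moreover have "C \<union> \<sigma> \<subseteq> vertices n"
      using b covers_subset swappable_subset_vertices by (force simp: res_basis_iff)
    moreover have "Poly_Mapping.keys t \<subseteq> vertices n"
      using res_module_closed[OF v, of "(C, \<sigma>)"] t(2) by (simp add: carrier_poly_ring in_keys_iff)
    ultimately show ?thesis using b by blast
  qed
  have g_supp: "(C, \<sigma>) \<in> res_basis n E i \<and> C \<union> \<sigma> \<subseteq> Poly_Mapping.keys m"
    if "g m (C, \<sigma>) \<noteq> 0" for m C \<sigma>
    using g_cell[OF that] by blast
  have "\<exists>w. (\<forall>C \<sigma>. w (C, \<sigma>) \<noteq> 0 \<longrightarrow>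
        (C, \<sigma>) \<in> res_basis n E (Suc i) \<and> C \<union> \<sigma> \<subseteq> Poly_Mapping.keys m) \<and>
      (\<forall>b. bd n w b = g m b)" for m
  proof (rule bd_exact[OF g_supp])
    show "bd n (g m) b = 0" for b
      using lookup_bd[of n "homog v" b m] cycle by (simp add: g_def[abs_def])
    show "(\<Sum>b \<in> res_basis n E 0. g m b) = 0" if "i = 0"
      using aug[OF that] by (simp add: g_def res_aug_homog lookup_sum[symmetric])
  qed
  then obtain w where w: "\<And>m C \<sigma>. w m (C, \<sigma>) \<noteq> 0 \<Longrightarrow>
        (C, \<sigma>) \<in> res_basis n E (Suc i) \<and> C \<union> \<sigma> \<subseteq> Poly_Mapping.keys m"
      and bw: "\<And>m b. bd n (w m) b = g m b"
    by metis
  \<comment> \<open>Only finitely many multidegrees occur in \<open>v\<close>. Restricting to them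
    makes the sum finite and, by \<open>g_cell\<close>, keeps \<open>W\<close> in the right
    variables.\<close>
  define M where "M = (\<Union>b \<in> res_basis n E i. Poly_Mapping.keys (homog v b))"
  have finM: "finite M" by (simp add: M_def finite_res_basis)
  have M: "m \<in> M \<longleftrightarrow> (\<exists>b. g m b \<noteq> 0)" for m
  proof
    show "m \<in> M \<Longrightarrow> \<exists>b. g m b \<noteq> 0" by (auto simp: M_def g_def in_keys_iff)
  next
    assume "\<exists>b. g m b \<noteq> 0"
    then obtain C \<sigma> where "g m (C, \<sigma>) \<noteq> 0" by auto
    then show "m \<in> M" using g_supp[of m C \<sigma>] by (auto simp: M_def g_def in_keys_iff)
  qed
  \<comment> \<open>Division by the multidegree of \<open>b\<close>: where \<open>w m b\<close> is
    nonzero, its support condition makes the truncated difference exact.\<close>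
  define W where "W b = (\<Sum>m \<in> M. Poly_Mapping.single (m - res_mdeg 0 b) (w m b))" for b
  have "homog W b = (\<Sum>m \<in> M. Poly_Mapping.single m (w m b))" for b
  proof -
    have "Poly_Mapping.single (res_mdeg 0 b) 1 * Poly_Mapping.single (m - res_mdeg 0 b) (w m b) =
        Poly_Mapping.single m (w m b)" for m
    proof (cases b)
      case (Pair C \<sigma>)
      show ?thesis
      proof (cases "w m b = 0")
        case False
        then have "(C, \<sigma>) \<in> res_basis n E (Suc i)" "C \<union> \<sigma> \<subseteq> Poly_Mapping.keys m"
          using w[of m C \<sigma>] Pair by auto
        then show ?thesis
          using res_basis_finite by (simp add: Pair mult_single res_basis_mdeg mdeg_prod_add_diff)
      qed simp
    qed
    then show ?thesis by (simp add: homog_def W_def sum_distrib_left)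
  qed
  then have lookup_W: "Poly_Mapping.lookup (homog W b) m = (if m \<in> M then w m b else 0)" for b m
    using finM by (simp add: lookup_sum lookup_single when_def)
  have W0: "W b = 0" if "b \<notin> res_basis n E (Suc i)" for b
  proof -
    have "w m b = 0" for m using w[of m "fst b" "snd b"] that by force
    then show ?thesis by (simp add: W_def)
  qed
  have W: "W \<in> carrier (res_module (Suc i))"
  proof -
    have "W b \<in> carrier ?S" for b
      unfolding W_def
    proof (rule poly_ring_sum_closed)
      fix m assume "m \<in> M"
      then have "Poly_Mapping.keys m \<subseteq> vertices n" using M[of m] g_cell[of m] by auto
      moreover have "Poly_Mapping.keys (m - res_mdeg 0 b) \<subseteq> Poly_Mapping.keys m"
        by (auto simp: in_keys_iff lookup_minus)
      ultimately show "Poly_Mapping.single (m - res_mdeg 0 b) (w m b) \<in> carrier ?S"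
        by (auto simp: carrier_poly_ring)
    qed
    then show ?thesis using W0 by (rule res_moduleI)
  qed
  have eq: "homog (res_diff n E (Suc i) W) b = homog v b" for b
  proof (rule poly_mapping_eqI)
    fix m
    have "Poly_Mapping.lookup (homog (res_diff n E (Suc i) W) b) m =
        bd n (\<lambda>c. if m \<in> M then w m c else 0) b"
      by (simp add: homog_res_diff[OF W0] lookup_bd lookup_W)
    also have "\<dots> = g m b"
    proof (cases "m \<in> M")
      case False
      then have "g m b = 0" using M by blast
      then show ?thesis using False by (simp add: bd_zero)
    qed (simp add: bw)
    finally show "Poly_Mapping.lookup (homog (res_diff n E (Suc i) W) b) m =
        Poly_Mapping.lookup (homog v b) m" by (simp add: g_def)
  qed
  have "res_diff n E (Suc i) W = v" by (rule ext, rule homog_cancel, rule eq)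
  then show ?thesis using W by blast
qed

text \<open>Transported from \<open>bd_bd\<close>: vanishing can be tested after
  \<open>homog\<close>, which is injective in each coordinate.\<close>

lemma res_diff_res_diff:
  assumes "v \<in> carrier (res_module (Suc i))" "res_diff n E (Suc i) v \<in> carrier (res_module i)"
  shows "res_diff n E i (res_diff n E (Suc i) v) = (\<lambda>_. 0)"
proof (rule ext, rule homog_cancel)
  fix b
  have 1: "homog (res_diff n E (Suc i) v) = bd n (homog v)"
    using res_module_support[OF assms(1)] by (intro ext homog_res_diff)
  have "finite \<sigma>" if "homog v (C, \<sigma>) \<noteq> 0" for C \<sigma>
    using homog_nonzero[OF that] res_module_support[OF assms(1)] res_basis_finite_snd by blast
  then have "bd n (bd n (homog v)) b = 0" by (rule bd_bd)
  moreover have "homog (res_diff n E i (res_diff n E (Suc i) v)) b =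
      bd n (homog (res_diff n E (Suc i) v)) b"
    using res_module_support[OF assms(2)] by (intro homog_res_diff)
  ultimately show "homog (res_diff n E i (res_diff n E (Suc i) v)) b = homog (\<lambda>_. 0) b"
    by (simp add: 1) (simp add: homog_def)
qed

lemma res_aug_res_diff:
  assumes "v \<in> carrier (res_module (Suc 0))"
  shows "res_aug n E (res_diff n E (Suc 0) v) = 0"
proof -
  have supp: "v b = 0" if "b \<notin> res_basis n E (Suc 0)" for b
    using assms that by (rule res_module_support)
  have "(\<Sum>b \<in> res_basis n E 0. bd n (homog v) b) = 0"
    by (intro sum_bd) (use supp homog_nonzero in blast)
  then show ?thesis by (simp add: res_aug_homog homog_res_diff[OF supp])
qed

section \<open>Closure, linearity, minimality and homogeneity of the maps\<close>

lemma unit_vec_closed: "unit_vec b b' \<in> carrier (poly_ring V)"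
  by (simp add: unit_vec_def)

lemma res_bdry_closed:
  assumes "c \<in> res_basis n E i"
  shows "res_bdry c b \<in> carrier (poly_ring (vertices n))"
proof (cases c)
  case (Pair C \<sigma>)
  have "s \<in> {1..n}" if "X s \<in> \<sigma>" for s using res_basis_indices(1) assms Pair that by blast
  then show ?thesis
    unfolding Pair res_bdry_def prod.case
    by (intro poly_ring_sum_closed poly_ring_closed poly_ring_diff_closed poly_ring_sign_closed
        pvar_closed unit_vec_closed) simp_all
qed

lemma res_bdry_support:
  assumes c: "c \<in> res_basis n E (Suc i)" and b: "b \<notin> res_basis n E i"
  shows "res_bdry c b = (0 :: (vertex, 'k::field) mpoly)"
proof (cases c)
  case (Pair C \<sigma>)
  have "unit_vec (swap C s, \<sigma> - {X s}) b = (0 :: (vertex, 'k) mpoly)"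
      "unit_vec (C, \<sigma> - {X s}) b = (0 :: (vertex, 'k) mpoly)" if "X s \<in> \<sigma>" for s
    using res_basis_face[of C \<sigma> i s] c b that Pair by (auto simp: unit_vec_def)
  then show ?thesis unfolding Pair res_bdry_def prod.case by (intro sum.neutral) simp
qed

lemma res_diff_closed:
  assumes "v \<in> carrier (res_module (Suc i))"
  shows "res_diff n E (Suc i) v \<in> carrier (res_module i)"
proof -
  have "res_diff n E (Suc i) v b \<in> carrier (poly_ring (vertices n))" for b
    unfolding res_diff_def
    by (intro poly_ring_sum_closed poly_ring_closed res_bdry_closed res_module_closed[OF assms])
  moreover have "res_diff n E (Suc i) v b = 0" if "b \<notin> res_basis n E i" for b
    using that by (simp add: res_diff_def res_bdry_support)
  ultimately show ?thesis by (rule res_moduleI)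
qed

lemma linear_res_diff:
  "linear_map (poly_ring (vertices n)) (res_module (Suc i)) (res_module i) (res_diff n E (Suc i))"
  unfolding linear_map_def using res_diff_closed
  by (auto simp: res_diff_def distrib_right sum.distrib sum_distrib_left mult.assoc)

text \<open>Each term of \<open>res_bdry\<close> carries a factor \<open>pvar (Y s)\<close> or
  \<open>pvar (X s)\<close>.\<close>

lemma res_diff_minimal:
  assumes "v \<in> carrier (res_module (Suc i))"
  shows "res_diff n E (Suc i) v b \<in> Idl\<^bsub>poly_ring (vertices n)\<^esub> (pvar ` vertices n)"
proof -
  let ?S = "poly_ring (vertices n) :: (vertex, 'a) mpoly ring"
  let ?I = "Idl\<^bsub>?S\<^esub> (pvar ` vertices n)"
  interpret S: cring ?S by (rule cring_poly_ring)
  have sub: "pvar ` vertices n \<subseteq> carrier ?S" by (auto intro: pvar_closed)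
  have I: "ideal ?I ?S" using sub by (rule S.genideal_ideal)
  have var: "pvar z \<in> ?I" if "z \<in> vertices n" for z
    using S.genideal_self[OF sub] that by blast
  have mult: "q * p \<in> ?I" "p * q \<in> ?I" if "p \<in> ?I" "q \<in> carrier ?S" for p q
    using ideal.I_l_closed[OF I that] ideal.I_r_closed[OF I that] by simp_all
  have plus: "p + q \<in> ?I" if "p \<in> ?I" "q \<in> ?I" for p q
    using additive_subgroup.a_closed[OF ideal.axioms(1)[OF I] that] by simp
  have diff: "p - q \<in> ?I" if "p \<in> ?I" "q \<in> ?I" for p q
    using plus[OF that(1) mult(1)[OF that(2) poly_ring_sign_closed[of 1]]] by simp
  have "res_bdry c b \<in> ?I" if "c \<in> res_basis n E (Suc i)" for c
  proof (cases c)
    case (Pair C \<sigma>)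
    have "s \<in> {1..n}" if "X s \<in> \<sigma>" for s
      using res_basis_indices(1) \<open>c \<in> _\<close> Pair that by blast
    then show ?thesis
      unfolding Pair res_bdry_def prod.case
      by (intro ideal_sum[OF I] mult(1)[OF diff] mult(2) var unit_vec_closed poly_ring_sign_closed) simp_all
  qed
  then show ?thesis
    unfolding res_diff_def by (intro ideal_sum[OF I] mult(1) res_module_closed[OF assms])
qed

text \<open>\<open>bd\<close> acts on each multidegree separately, and the coefficients of
  \<open>homog v\<close> away from \<open>m\<close> vanish.\<close>

lemma res_diff_homogeneous:
  assumes "v \<in> carrier (res_module (Suc i))" and hom: "hom_vec (res_mdeg (Suc i)) m v"
  shows "hom_vec (res_mdeg i) m (res_diff n E (Suc i) v)"
  unfolding hom_vec_iff
proof (intro allI impI, rule ccontr)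
  fix b m'
  assume nz: "Poly_Mapping.lookup (homog (res_diff n E (Suc i) v) b) m' \<noteq> 0" and "m' \<noteq> m"
  have "Poly_Mapping.lookup (homog (res_diff n E (Suc i) v) b) m' =
      bd n (\<lambda>c. Poly_Mapping.lookup (homog v c) m') b"
    using homog_res_diff[OF res_module_support[OF assms(1)]] by (simp add: lookup_bd)
  moreover have "(\<lambda>c. Poly_Mapping.lookup (homog v c) m') = (\<lambda>c. 0)"
    using hom \<open>m' \<noteq> m\<close> unfolding hom_vec_iff by blast
  ultimately show False using nz by (simp add: bd_zero)
qed

lemma res_aug_homogeneous:
  assumes hom: "hom_vec (res_mdeg 0) m v"
  shows "hom_poly m (res_aug n E v)"
proof -
  have "m' = m" if nz: "Poly_Mapping.lookup (res_aug n E v) m' \<noteq> 0" for m'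
  proof -
    obtain b where "Poly_Mapping.lookup (homog v b) m' \<noteq> 0"
      using nz unfolding res_aug_homog lookup_sum by (rule sum.not_neutral_contains_not_neutral)
    then show ?thesis using hom unfolding hom_vec_iff by blast
  qed
  then show ?thesis by (auto simp: hom_poly_def in_keys_iff)
qed

lemma res_aug_linear:
  "res_aug n E (\<lambda>b. u b + v b) = res_aug n E u + res_aug n E v"
  "res_aug n E (\<lambda>b. r * v b) = r * res_aug n E v"
  by (simp_all add: res_aug_def distrib_right sum.distrib sum_distrib_left mult.assoc)

section \<open>The cover ideal as image of the augmentation, and the kernels\<close>

lemma res_basis_0: "b \<in> res_basis n E 0 \<Longrightarrow> fst b \<in> covers"
  by (auto simp: res_basis_def)

lemma cover_generators_closed: "pprod ` covers \<subseteq> carrier (poly_ring (vertices n))"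
  using covers_subset by (auto intro: pprod_closed)

lemma ideal_cover_ideal: "ideal (cover_ideal (vertices n) E) (poly_ring (vertices n))"
proof -
  interpret S: cring "poly_ring (vertices n)" by (rule cring_poly_ring)
  show ?thesis unfolding cover_ideal_def using cover_generators_closed by (rule S.genideal_ideal)
qed

text \<open>Each generator of the cover ideal is the image of a unit vector, and the image is itself
  an ideal, so it contains the ideal they generate.\<close>

lemma res_aug_image:
  "res_aug n E ` carrier (res_module 0) = (cover_ideal (vertices n) E :: (vertex, 'k::field) mpoly set)"
proof
  let ?S = "poly_ring (vertices n) :: (vertex, 'k) mpoly ring"
  let ?J = "cover_ideal (vertices n) E :: (vertex, 'k) mpoly set"
  let ?I = "res_aug n E ` carrier (res_module 0) :: (vertex, 'k) mpoly set"
  interpret S: cring ?S by (rule cring_poly_ring)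
  note J = ideal_cover_ideal[where ?'a = 'k]
  have gen: "pprod C \<in> ?J" if "C \<in> covers" for C
    using S.genideal_self[OF cover_generators_closed] that unfolding cover_ideal_def by blast
  show "?I \<subseteq> ?J"
  proof
    fix p assume "p \<in> ?I"
    then obtain v where v: "p = res_aug n E v" "v \<in> carrier (res_module 0)" by blast
    have "v b * pprod (fst b) \<in> ?J" if "b \<in> res_basis n E 0" for b
      using ideal.I_l_closed[OF J gen[OF res_basis_0[OF that]], OF res_module_closed[OF v(2)]] by simp
    then show "p \<in> ?J" unfolding v(1) res_aug_def by (rule ideal_sum[OF J])
  qed
  have scale: "r * p \<in> ?I" if "p \<in> ?I" "r \<in> carrier ?S" for p r
  proof -
    obtain v where v: "p = res_aug n E v" "v \<in> carrier (res_module 0)" using \<open>p \<in> ?I\<close> by blast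
    have "(\<lambda>b. r * v b) \<in> carrier (res_module 0)"
      using \<open>r \<in> carrier ?S\<close> res_module_closed[OF v(2)] res_module_support[OF v(2)]
      by (intro res_moduleI poly_ring_closed) simp_all
    then show ?thesis unfolding v(1) res_aug_linear(2)[symmetric] by (rule imageI)
  qed
  have plus: "p + q \<in> ?I" if "p \<in> ?I" "q \<in> ?I" for p q
  proof -
    obtain u v where uv: "p = res_aug n E u" "u \<in> carrier (res_module 0)"
        "q = res_aug n E v" "v \<in> carrier (res_module 0)"
      using \<open>p \<in> ?I\<close> \<open>q \<in> ?I\<close> by blast
    have "(\<lambda>b. u b + v b) \<in> carrier (res_module 0)"
      using res_module_closed[OF uv(2)] res_module_closed[OF uv(4)]
        res_module_support[OF uv(2)] res_module_support[OF uv(4)]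
      by (intro res_moduleI poly_ring_closed) simp_all
    then show ?thesis unfolding uv(1,3) res_aug_linear(1)[symmetric] by (rule imageI)
  qed
  have carr: "?I \<subseteq> carrier ?S"
    using \<open>?I \<subseteq> ?J\<close> additive_subgroup.a_subset[OF ideal.axioms(1)[OF J]] by blast
  have "ideal ?I ?S"
  proof (rule idealI)
    show "ring ?S" by (rule S.ring_axioms)
    show "subgroup ?I (add_monoid ?S)"
    proof (rule S.add.subgroupI)
      show "?I \<subseteq> carrier ?S" by (rule carr)
      have "(\<lambda>_. 0) \<in> carrier (res_module 0)" by (rule res_moduleI) simp_all
      then show "?I \<noteq> {}" by blast
      \<comment> \<open>Additive inverses come from scaling by \<open>(-1) ^ 1\<close>.\<close>
      show "\<ominus>\<^bsub>?S\<^esub> p \<in> ?I" if "p \<in> ?I" for p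
        using scale[OF that poly_ring_sign_closed[of 1]] that carr
        by (subst a_inv_poly_ring) auto
      show "p \<oplus>\<^bsub>?S\<^esub> q \<in> ?I" if "p \<in> ?I" "q \<in> ?I" for p q
        using plus[OF that] by simp
    qed
    show "r \<otimes>\<^bsub>?S\<^esub> p \<in> ?I" "p \<otimes>\<^bsub>?S\<^esub> r \<in> ?I" if "p \<in> ?I" "r \<in> carrier ?S" for p r
      using scale[OF that] by (simp_all add: mult.commute)
  qed
  moreover have "pprod ` covers \<subseteq> ?I"
  proof
    fix p :: "(vertex, 'k) mpoly" assume "p \<in> pprod ` covers"
    then obtain C where C: "p = pprod C" "C \<in> covers" by blast
    have mem: "(C, {}) \<in> res_basis n E 0" using C(2) by (simp add: res_basis_iff)
    have unit: "unit_vec (C, {}) \<in> carrier (res_module 0)"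
      using mem unit_vec_closed by (intro res_moduleI) (auto simp: unit_vec_def)
    have "res_aug n E (unit_vec (C, {})) = p"
    proof -
      have "res_aug n E (unit_vec (C, {})) =
          (\<Sum>b \<in> res_basis n E 0. if b = (C, {}) then p else 0)"
        unfolding res_aug_def by (intro sum.cong) (auto simp: unit_vec_def C(1))
      then show ?thesis using mem finite_res_basis by simp
    qed
    then show "p \<in> ?I" using unit by (intro image_eqI) simp_all
  qed
  ultimately show "?J \<subseteq> ?I" unfolding cover_ideal_def by (rule S.genideal_minimal)
qed

lemma linear_res_aug:
  "linear_map (poly_ring (vertices n)) (res_module 0)
     (ideal_module (poly_ring (vertices n)) (cover_ideal (vertices n) E)) (res_aug n E)"
  unfolding linear_map_def using res_aug_image by (auto simp: res_aug_linear)

lemma kernel_res_aug: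
  "{v \<in> carrier (res_module 0). res_aug n E v = 0} = res_diff n E 1 ` carrier (res_module 1)"
proof (intro equalityI subsetI)
  fix v assume "v \<in> {v \<in> carrier (res_module 0). res_aug n E v = 0}"
  then have v: "v \<in> carrier (res_module 0)" "res_aug n E v = 0" by auto
  \<comment> \<open>In degree 0 every vector is a cycle for \<open>bd\<close>: a cell with a proper
    face has a nonempty second component.\<close>
  have "bd n (homog v) b = 0" for b
  proof (cases b)
    case (Pair C \<tau>)
    have "homog v (D, insert (X s) \<tau>) = 0" if "X s \<notin> \<tau>" for D s
    proof -
      have "(D, insert (X s) \<tau>) \<notin> res_basis n E 0"
      proof
        assume b: "(D, insert (X s) \<tau>) \<in> res_basis n E 0"
        then have "card (insert (X s) \<tau>) = 0" by (simp add: res_basis_iff)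
        then show False using res_basis_finite_snd[OF b] by simp
      qed
      then show ?thesis using res_module_support[OF v(1)] by (simp add: homog_def)
    qed
    then show ?thesis
      unfolding Pair bd_def slide_def prod.case by (intro sum.neutral) simp
  qed
  then show "v \<in> res_diff n E 1 ` carrier (res_module 1)"
    using res_exact[OF v(1)] v(2) by simp
next
  fix v assume "v \<in> res_diff n E 1 ` carrier (res_module 1)"
  then show "v \<in> {v \<in> carrier (res_module 0). res_aug n E v = 0}"
    using res_diff_closed[of _ 0] res_aug_res_diff by auto
qed

lemma kernel_res_diff:
  "{v \<in> carrier (res_module (Suc i)). res_diff n E (Suc i) v = (\<lambda>_. 0)} =
    res_diff n E (Suc (Suc i)) ` carrier (res_module (Suc (Suc i)))"
proof (intro equalityI subsetI)
  fix v assume "v \<in> {v \<in> carrier (res_module (Suc i)). res_diff n E (Suc i) v = (\<lambda>_. 0)}"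
  then have v: "v \<in> carrier (res_module (Suc i))" "res_diff n E (Suc i) v = (\<lambda>_. 0)" by auto
  have "bd n (homog v) b = homog (res_diff n E (Suc i) v) b" for b
    using res_module_support[OF v(1)] by (intro homog_res_diff[symmetric])
  then have "bd n (homog v) b = 0" for b by (simp add: v(2) homog_def)
  then show "v \<in> res_diff n E (Suc (Suc i)) ` carrier (res_module (Suc (Suc i)))"
    using res_exact[OF v(1)] by simp
next
  fix v assume "v \<in> res_diff n E (Suc (Suc i)) ` carrier (res_module (Suc (Suc i)))"
  then show "v \<in> {v \<in> carrier (res_module (Suc i)). res_diff n E (Suc i) v = (\<lambda>_. 0)}"
    using res_diff_closed res_diff_res_diff by auto
qed

end

theorem theorem3p5:
  fixes n :: nat and E :: "vertex set set"
  assumes "simple_graph (vertices n) E"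
    and "very_well_covered TYPE('k::field) (vertices n) E"
    and "cohen_macaulay_graph TYPE('k) (vertices n) E"
    and "standard_labelling n E"
  shows "minimal_multigraded_free_resolution (vertices n)
           (cover_ideal (vertices n) E :: (vertex, 'k) mpoly set)
           (res_basis n E) res_mdeg (res_diff n E) (res_aug n E)"
proof -
  \<comment> \<open>Unmixedness is part of being very well-covered.\<close>
  interpret unmixed_standard_graph n E
    using assms by unfold_locales (auto simp: very_well_covered_def)
  show ?thesis
    unfolding minimal_multigraded_free_resolution_def Let_def
  proof (intro conjI allI impI ballI)
    show "ideal (cover_ideal (vertices n) E :: (vertex, 'k) mpoly set) (poly_ring (vertices n))"
      by (rule ideal_cover_ideal)
    show "finite (res_basis n E i)" for i by (rule finite_res_basis)
    show "linear_map (poly_ring (vertices n)) (res_module 0)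
        (ideal_module (poly_ring (vertices n)) (cover_ideal (vertices n) E :: (vertex, 'k) mpoly set))
        (res_aug n E)"
      by (rule linear_res_aug)
    show "hom_poly m (res_aug n E v)"
      if "hom_vec (res_mdeg 0) m v" for m and v :: "_ \<Rightarrow> (vertex, 'k) mpoly"
      using that by (rule res_aug_homogeneous)
    show "res_aug n E ` carrier (res_module 0) = (cover_ideal (vertices n) E :: (vertex, 'k) mpoly set)"
      by (rule res_aug_image)
    show "{v \<in> carrier (res_module 0). res_aug n E v = \<zero>\<^bsub>poly_ring (vertices n)\<^esub>} =
        res_diff n E 1 ` carrier (res_module 1 :: ((vertex, 'k) mpoly, _) module)"
      unfolding poly_ring_simps by (rule kernel_res_aug)
  next
    fix i :: nat assume "0 < i"
    \<comment> \<open>Writing \<open>i\<close> as a successor removes the truncated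
      \<open>i - 1\<close> and fits the indexing of the lemmas on \<open>res_diff\<close>.\<close>
    then obtain j where i: "i = Suc j" by (cases i) auto
    show "linear_map (poly_ring (vertices n)) (res_module i)
        (res_module (i - 1) :: ((vertex, 'k) mpoly, _) module) (res_diff n E i)"
      unfolding i by (simp add: linear_res_diff)
    show "{v \<in> carrier (res_module i). res_diff n E i v = \<zero>\<^bsub>res_module (i - 1)\<^esub>} =
        res_diff n E (i + 1) ` carrier (res_module (i + 1) :: ((vertex, 'k) mpoly, _) module)"
      unfolding i using kernel_res_diff[of j] by simp
    fix v :: "vertex set \<times> vertex set \<Rightarrow> (vertex, 'k) mpoly"
    assume v: "v \<in> carrier (res_module i)"
    show "hom_vec (res_mdeg (i - 1)) m (res_diff n E i v)" if "hom_vec (res_mdeg i) m v" for m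
      using v that res_diff_homogeneous unfolding i by simp
    show "res_diff n E i v b \<in> Idl\<^bsub>poly_ring (vertices n)\<^esub> (pvar ` vertices n)" for b
      using v res_diff_minimal unfolding i by simp
  qed
qed

end
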